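(* Consider the contextual bilateral trade problem in the one-bit feedback model. There exists a profit-maximizing algorithm that achieves regret $O(d\log\log T+d\log d)$ and whose negative profit $\sum_{t=1}^T\max\{0,-\mathrm{Profit}_t(p_t,q_t)\}$ is at most $O(d\log d)$.
   Context: Contextual bilateral trade: Let $\mathbb{B}=\{w\in\mathbb{R}^d:\|w\|_2\le 1\}$. There are two fixed vectors $s,b\in\mathbb{B}$ unknown to the learner. At each time $t=1,\dots,T$, the learner observes a context $x_t\in\mathbb{B}$ (the contexts and $s,b$ are fixed in advance by an oblivious adversary; this is an instance), and posts a price $p_t$ to the seller and $q_t$ to the buyer (possibly $p_t>q_t$). Valuations: $s_t=\langle s,x_t\rangle$, $b_t=\langle b,x_t\rangle$; the trade happens iff $s_t\le p_t$ and $q_t\le b_t$. Profit: $\mathrm{Profit}_t(p_t,q_t)=(q_t-p_t)\,\mathbb{1}\{s_t\le p_t\}\mathbb{1}\{q_t\le b_t\}$. One-bit feedback: after each round the learner observes only $\mathbb{1}\{s_t\le p_t\}\cdot\mathbb{1}\{q_t\le b_t\}$. Regret of a (possibly randomized) algorithm $\mathcal{A}$: $R_T(\mathcal{A})=\sup_{\mathcal{I}}\mathbb{E}\big[\sum_{t=1}^T (b_t-s_t)_+-\sum_{t=1}^T\mathrm{Profit}_t(p_t,q_t)\big]$. The $O(\cdot)$ hides absolute constants independent of $d$ and $T$. *)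

theory Defs
  imports "HOL-Probability.Probability"
begin

text \<open>Vectors of R^d are represented as functions nat => real that vanish
  outside the index range {0..<d}; the dimension d varies inside the statement.\<close>

type_synonym rvec = "nat \<Rightarrow> real"

definition ip :: "nat \<Rightarrow> rvec \<Rightarrow> rvec \<Rightarrow> real" where
  "ip d u v = (\<Sum>i<d. u i * v i)"

definition unit_ball :: "nat \<Rightarrow> rvec set" where
  "unit_ball d = {w. (\<forall>i\<ge>d. w i = 0) \<and> sqrt (ip d w w) \<le> 1}"

text \<open>A deterministic learner (policy): given the history of past (context, one-bit feedback)
  pairs and the current context, it posts the pair (p, q) = (seller price, buyer price).
  A randomized algorithm is a probability distribution over such policies.\<close>

type_synonym policy = "(rvec \<times> bool) list \<Rightarrow> rvec \<Rightarrow> real \<times> real"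

definition trade :: "real \<Rightarrow> real \<Rightarrow> real \<Rightarrow> real \<Rightarrow> bool" where
  "trade st bt p q \<longleftrightarrow> st \<le> p \<and> q \<le> bt"

definition profit :: "real \<Rightarrow> real \<Rightarrow> real \<Rightarrow> real \<Rightarrow> real" where
  "profit st bt p q = (if trade st bt p q then q - p else 0)"

text \<open>History after the first n rounds (rounds are numbered 1,2,...; context of round t is x t).\<close>

fun hist :: "nat \<Rightarrow> policy \<Rightarrow> rvec \<Rightarrow> rvec \<Rightarrow> (nat \<Rightarrow> rvec) \<Rightarrow> nat \<Rightarrow> (rvec \<times> bool) list" where
  "hist d P s b x 0 = []"
| "hist d P s b x (Suc n) =
     (let h = hist d P s b x n; xt = x (Suc n); pq = P h xt
      in h @ [(xt, trade (ip d s xt) (ip d b xt) (fst pq) (snd pq))])"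

definition prices :: "nat \<Rightarrow> policy \<Rightarrow> rvec \<Rightarrow> rvec \<Rightarrow> (nat \<Rightarrow> rvec) \<Rightarrow> nat \<Rightarrow> real \<times> real" where
  "prices d P s b x t = P (hist d P s b x (t - 1)) (x t)"

definition round_profit :: "nat \<Rightarrow> policy \<Rightarrow> rvec \<Rightarrow> rvec \<Rightarrow> (nat \<Rightarrow> rvec) \<Rightarrow> nat \<Rightarrow> real" where
  "round_profit d P s b x t =
     profit (ip d s (x t)) (ip d b (x t)) (fst (prices d P s b x t)) (snd (prices d P s b x t))"

definition loss :: "nat \<Rightarrow> nat \<Rightarrow> policy \<Rightarrow> rvec \<Rightarrow> rvec \<Rightarrow> (nat \<Rightarrow> rvec) \<Rightarrow> real" where
  "loss d T P s b x =
     (\<Sum>t=1..T. max 0 (ip d b (x t) - ip d s (x t))) - (\<Sum>t=1..T. round_profit d P s b x t)"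

definition neg_profit :: "nat \<Rightarrow> nat \<Rightarrow> policy \<Rightarrow> rvec \<Rightarrow> rvec \<Rightarrow> (nat \<Rightarrow> rvec) \<Rightarrow> real" where
  "neg_profit d T P s b x = (\<Sum>t=1..T. max 0 (- round_profit d P s b x t))"

definition valid_instance :: "nat \<Rightarrow> nat \<Rightarrow> rvec \<Rightarrow> rvec \<Rightarrow> (nat \<Rightarrow> rvec) \<Rightarrow> bool" where
  "valid_instance d T s b x \<longleftrightarrow>
     s \<in> unit_ball d \<and> b \<in> unit_ball d \<and> (\<forall>t\<in>{1..T}. x t \<in> unit_ball d)"

end

theory Submission
  imports Defs
begin

text \<open>The learner keeps the convex sets of seller and buyer vectors consistent with the feedback.
  In each round these give intervals for both valuations; only the agent with the wider interval
  (width \<open>w\<close>) is probed, the other one gets a price that it accepts for sure, so the single bit is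
  informative about the probed agent.

  If the two intervals overlap, every outcome costs at most \<open>2w\<close>, and a constant-fraction cut of the
  relaxed volume is posted. If the buyer's interval lies above the seller's, trade is profitable but
  a failed trade may cost \<open>2\<close>; the price then cuts off only a fraction \<open>\<delta>\<close> of the volume,
  between the square root and the fourth root of \<open>w\<close> up to constants, so that a failure is rewarded by a factor \<open>2\<delta>\<close> in volume. This needs
  only doubly exponential scales, whence \<open>ln ln T\<close>; losses at the overlapping scales decay
  geometrically, so they and the negative profit sum to \<open>O(d ln d)\<close>.

  The volume at a scale \<open>z\<close> is that of the set with all constraints relaxed by \<open>z\<close>. It is between
  \<open>(2z/d)\<^sup>d\<close> and \<open>4\<^sup>d\<close>, and since a thin slab of a wide convex body has small volume, cuts remain
  effective after relaxation. A weighted sum over all scales of the logarithms of these volumes is the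
  potential that pays for the rounds. The resulting policy is deterministic.\<close>

section \<open>Thin slabs of convex bodies\<close>

text \<open>Lebesgue measure on \<open>R^d\<close>. Its points are \<open>undefined\<close> outside
  \<open>{..<d}\<close>, whereas vectors of \<open>unit_ball\<close> vanish there; hence the uses of
  \<open>restrict\<close> further on.\<close>

definition vol_space :: "nat \<Rightarrow> rvec measure" where
  "vol_space d = (\<Pi>\<^sub>M i\<in>{..<d}. lborel)"

definition homothety :: "nat \<Rightarrow> rvec \<Rightarrow> real \<Rightarrow> rvec \<Rightarrow> rvec" where
  "homothety d a r y = (\<lambda>i\<in>{..<d}. a i + r * (y i - a i))"

lemma space_vol_space: "space (vol_space d) = {..<d} \<rightarrow>\<^sub>E UNIV"
  by (simp add: vol_space_def space_PiM)

lemma emeasure_vol_space_PiE: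
  assumes "\<And>i. i < d \<Longrightarrow> A i \<in> sets borel"
  shows "emeasure (vol_space d) (Pi\<^sub>E {..<d} A) = (\<Prod>i<d. emeasure lborel (A i))"
proof -
  interpret product_sigma_finite "\<lambda>_. lborel :: real measure" ..
  show ?thesis
    unfolding vol_space_def using assms by (subst emeasure_PiM) auto
qed

lemma homothety_measurable [measurable]: "homothety d a r \<in> vol_space d \<rightarrow>\<^sub>M vol_space d"
  unfolding homothety_def vol_space_def by measurable

lemma ip_measurable [measurable]: "ip d x \<in> borel_measurable (vol_space d)"
  unfolding ip_def vol_space_def by measurable

text \<open>Both sides are measures in \<open>A\<close>, so agreement on boxes suffices; there each
  coordinate is an affine map of the line and contributes one factor \<open>r\<close>.\<close>

lemma emeasure_homothety_vimage:
  assumes r: "r > 0" and A: "A \<in> sets (vol_space d)"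
  shows "emeasure (vol_space d) A =
    ennreal (r ^ d) * emeasure (vol_space d) (homothety d a r -` A \<inter> space (vol_space d))"
proof -
  interpret product_sigma_finite "\<lambda>_. lborel :: real measure" ..
  let ?P = "scale_measure (ennreal (r ^ d)) (distr (vol_space d) (vol_space d) (homothety d a r))"
  have "?P = (\<Pi>\<^sub>M i\<in>{..<d}. lborel)"
  proof (rule PiM_eqI)
    show "sets ?P = sets (\<Pi>\<^sub>M i\<in>{..<d}. lborel)" by (simp add: vol_space_def)
  next
    fix B :: "nat \<Rightarrow> real set" assume B: "\<And>i. i \<in> {..<d} \<Longrightarrow> B i \<in> sets lborel"
    have B': "Pi\<^sub>E {..<d} B \<in> sets (vol_space d)"
      unfolding vol_space_def using B by (intro sets_PiM_I_finite) auto
    have v: "homothety d a r -` Pi\<^sub>E {..<d} B \<inter> space (vol_space d) =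
        Pi\<^sub>E {..<d} (\<lambda>i. (\<lambda>y. (a i - r * a i) + r * y) -` B i)"
      by (auto simp: homothety_def space_vol_space PiE_iff algebra_simps)
    have e: "emeasure lborel (B i) = ennreal r * emeasure lborel ((\<lambda>y. (a i - r * a i) + r * y) -` B i)"
      if "i < d" for i
    proof -
      have "emeasure lborel (B i) =
        emeasure (density (distr lborel borel (\<lambda>y. (a i - r * a i) + r * y)) (\<lambda>_. ennreal \<bar>r\<bar>)) (B i)"
        using lborel_real_affine[of r "a i - r * a i"] r by simp
      also have "\<dots> = ennreal r * emeasure lborel ((\<lambda>y. (a i - r * a i) + r * y) -` B i)"
        using B[of i] that r by (simp add: emeasure_density_const emeasure_distr)
      finally show ?thesis .
    qed
    have "emeasure ?P (Pi\<^sub>E {..<d} B) =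
      ennreal (r ^ d) * emeasure (vol_space d) (Pi\<^sub>E {..<d} (\<lambda>i. (\<lambda>y. (a i - r * a i) + r * y) -` B i))"
      using B' by (simp add: emeasure_distr v)
    also have "\<dots> = ennreal (r ^ d) * (\<Prod>i<d. emeasure lborel ((\<lambda>y. (a i - r * a i) + r * y) -` B i))"
    proof (subst emeasure_vol_space_PiE)
      fix i assume "i < d"
      then have "B i \<in> sets borel" using B by simp
      then have "(\<lambda>y. (a i - r * a i) + r * y) -` B i \<inter> space borel \<in> sets borel"
        by (intro measurable_sets) auto
      then show "(\<lambda>y. (a i - r * a i) + r * y) -` B i \<in> sets borel" by simp
    qed simp
    also have "\<dots> = (\<Prod>i<d. emeasure lborel (B i))"
      using r by (simp add: e prod.distrib ennreal_power)
    finally show "emeasure ?P (Pi\<^sub>E {..<d} B) = (\<Prod>i\<in>{..<d}. emeasure lborel (B i))" .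
  qed simp
  then have "emeasure ?P A = emeasure (vol_space d) A" by (simp add: vol_space_def)
  then show ?thesis using A by (simp add: emeasure_distr)
qed

lemma ip_uminus_left [simp]: "ip d (\<lambda>i. - x i) y = - ip d x y"
  by (simp add: ip_def sum_negf)

lemma ip_commute: "ip d u v = ip d v u"
  by (simp add: ip_def mult.commute)

lemma ip_restrict [simp]: "ip d x (restrict y {..<d}) = ip d x y"
  by (simp add: ip_def)

lemma ip_homothety [simp]: "ip d x (homothety d a r y) = ip d x a + r * (ip d x y - ip d x a)"
  by (simp add: ip_def homothety_def sum.distrib sum_subtractf sum_distrib_left algebra_simps)

text \<open>Convexity, phrased as closure under contractions towards a member.\<close>

definition homothety_closed :: "nat \<Rightarrow> rvec set \<Rightarrow> bool" where
  "homothety_closed d R \<longleftrightarrow> (\<forall>a\<in>R. \<forall>y\<in>R. \<forall>r\<in>{0..1}. homothety d a r y \<in> R)"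

text \<open>Homothetic copies of the slab, centred at a point \<open>a\<close> far from it and with ratios
  \<open>1 - 2jh/e\<close> for \<open>j < N\<close>, are pairwise disjoint, stay inside \<open>R\<close>, and each keeps at least half
  of the volume by Bernoulli's inequality.\<close>

lemma slab_volume_one_sided:
  assumes R: "R \<in> sets (vol_space d)" "emeasure (vol_space d) R \<noteq> \<infinity>" "homothety_closed d R"
    and a: "a \<in> R" and h: "h > 0" and e: "ip d x a + e = g + h" "4 * real d * real N * h \<le> e"
    and d: "d > 0"
  shows "real N * measure (vol_space d) {y\<in>R. g \<le> ip d x y \<and> ip d x y \<le> g + h}
    \<le> 2 * measure (vol_space d) R"
proof (cases "N = 0")
  case False
  let ?M = "vol_space d"
  define S where "S = {y\<in>R. g \<le> ip d x y \<and> ip d x y \<le> g + h}"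
  have RM: "R \<subseteq> space ?M" using R(1) by (rule sets.sets_into_space)
  have S: "S \<in> sets ?M"
  proof -
    have "S = R \<inter> {y\<in>space ?M. g \<le> ip d x y \<and> ip d x y \<le> g + h}" using RM by (auto simp: S_def)
    also have "\<dots> \<in> sets ?M" using R(1) by measurable
    finally show ?thesis .
  qed
  have "0 < 4 * real d * real N * h" using False h d by simp
  then have epos: "e > 0" using e by linarith
  define l where "l j = 1 - real j * (2 * h / e)" for j :: nat
  have l1: "l j \<le> 1" for j using h epos by (simp add: l_def)
  have hl: "real d * (real j * (2 * h / e)) \<le> 1/2" if "j < N" for j
  proof -
    have "4 * real d * real j * h \<le> 4 * real d * real N * h"
      using that h by (intro mult_right_mono mult_left_mono) auto
    then have "4 * real d * real j * h \<le> e" using e by linarith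
    then show ?thesis using epos by (simp add: field_simps)
  qed
  have lpow: "l j ^ d \<ge> 1/2" and lpos: "l j > 0" if "j < N" for j
  proof -
    have "1 * (real j * (2 * h / e)) \<le> real d * (real j * (2 * h / e))"
      using d h epos by (intro mult_right_mono) auto
    then have *: "real j * (2 * h / e) \<le> 1/2" using hl[OF that] by linarith
    then show "l j > 0" by (simp add: l_def)
    have "1 + real d * (- (real j * (2 * h / e))) \<le> (1 + - (real j * (2 * h / e))) ^ d"
      using * by (intro Bernoulli_inequality) linarith
    then show "l j ^ d \<ge> 1/2" using hl[OF that] by (simp add: l_def)
  qed
  \<comment> \<open>The contracted copy of \<open>S\<close> with ratio \<open>l j\<close>, written
    as a preimage under the inverse map to make it measurable.\<close>
  define I where "I j = homothety d a (1 / l j) -` S \<inter> space ?M" for j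
  have I_sets: "I j \<in> sets ?M" for j unfolding I_def using S by measurable
  have hom_inv: "homothety d a (l j) (homothety d a (1 / l j) y) = y" if "y \<in> space ?M" "j < N" for y j
    using that lpos[of j] by (auto simp: homothety_def space_vol_space PiE_iff extensional_def fun_eq_iff)
  have I_sub: "I j \<subseteq> R" if "j < N" for j
  proof
    fix y assume y: "y \<in> I j"
    then have "homothety d a (1 / l j) y \<in> R" by (auto simp: I_def S_def)
    then have "homothety d a (l j) (homothety d a (1 / l j) y) \<in> R"
      using R(3) a l1[of j] lpos[OF that] unfolding homothety_closed_def by auto
    then show "y \<in> R" using hom_inv[of y j] y that by (auto simp: I_def)
  qed
  have I_bounds: "l j * (e - h) \<le> ip d x y - ip d x a" "ip d x y - ip d x a \<le> l j * e"
    if "y \<in> I j" "j < N" for y j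
  proof -
    have "homothety d a (1 / l j) y \<in> S" using that by (auto simp: I_def)
    then have "e - h \<le> (ip d x y - ip d x a) / l j" "(ip d x y - ip d x a) / l j \<le> e"
      using e(1) by (auto simp: S_def)
    then show "l j * (e - h) \<le> ip d x y - ip d x a" "ip d x y - ip d x a \<le> l j * e"
      using lpos[OF that(2)] by (simp_all add: field_simps)
  qed
  \<comment> \<open>Along \<open>x\<close> the far faces of two copies are at least
    \<open>2 * h\<close> apart, while each copy is at most \<open>h\<close> thick.\<close>
  have disj: "I i \<inter> I j = {}" if "i < j" "j < N" for i j
  proof (rule ccontr)
    assume "I i \<inter> I j \<noteq> {}"
    then obtain y where y: "y \<in> I i" "y \<in> I j" by blast
    have "l i * (e - h) \<le> l j * e"
      using I_bounds(1)[OF y(1)] I_bounds(2)[OF y(2)] that by linarith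
    then have "(l i - l j) * e \<le> l i * h" by (simp add: algebra_simps)
    moreover have "l i * h \<le> h" using l1[of i] h by simp
    moreover have "(l i - l j) * e = 2 * h * (real j - real i)"
      using epos by (simp add: l_def field_simps)
    moreover have "2 * h * (real j - real i) \<ge> 2 * h * 1"
      using that h by (intro mult_left_mono) auto
    ultimately show False using h by linarith
  qed
  have fin: "emeasure ?M (I j) \<noteq> \<infinity>" if "j < N" for j
    using emeasure_mono[OF I_sub[OF that] R(1)] R(2) by (auto simp: top_unique)
  have I_vol: "measure ?M S / 2 \<le> measure ?M (I j)" if "j < N" for j
  proof -
    have "emeasure ?M S = ennreal ((1 / l j) ^ d) * emeasure ?M (I j)"
      unfolding I_def using S lpos[OF that] by (intro emeasure_homothety_vimage) auto
    then have "measure ?M S = (1 / l j) ^ d * measure ?M (I j)"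
      using lpos[OF that] by (simp add: measure_def enn2real_mult)
    then have "measure ?M (I j) = l j ^ d * measure ?M S"
      using lpos[OF that] by (simp add: power_one_over)
    moreover have "1/2 * measure ?M S \<le> l j ^ d * measure ?M S"
      using lpow[OF that] by (intro mult_right_mono) auto
    ultimately show ?thesis by simp
  qed
  have "real N * (measure ?M S / 2) = (\<Sum>j<N. measure ?M S / 2)" by simp
  also have "\<dots> \<le> (\<Sum>j<N. measure ?M (I j))" using I_vol by (intro sum_mono) auto
  also have "\<dots> = measure ?M (\<Union>j\<in>{..<N}. I j)"
  proof (rule measure_finite_Union[symmetric])
    show "disjoint_family_on I {..<N}"
      unfolding disjoint_family_on_def
      by (metis disj inf_commute lessThan_iff linorder_neqE_nat)
  qed (use I_sets fin in auto)
  also have "\<dots> \<le> measure ?M R"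
    using I_sub I_sets R by (intro measure_mono_fmeasurable) (auto simp: fmeasurable_def less_top)
  finally show ?thesis by (simp add: S_def)
qed simp

text \<open>The points \<open>a\<close> and \<open>a'\<close> are at least \<open>w / 2\<close>
  apart along \<open>x\<close>, so one of them is \<open>w / 4\<close> away from the face of the
  slab opposite to it. The one-sided bound is applied from there, for \<open>a'\<close> in the
  reversed direction.\<close>

lemma slab_volume:
  assumes R: "R \<in> sets (vol_space d)" "emeasure (vol_space d) R \<noteq> \<infinity>" "homothety_closed d R"
    and a: "a \<in> R" "a' \<in> R" "w / 2 \<le> ip d x a' - ip d x a"
    and z: "z > 0" "160 * real d * z \<le> \<delta> * w" and \<delta>: "0 < \<delta>" "\<delta> \<le> 1" and d: "d > 0"
  shows "measure (vol_space d) {y\<in>R. g \<le> ip d x y \<and> ip d x y \<le> g + 2 * z}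
    \<le> \<delta> / 2 * measure (vol_space d) R"
proof -
  \<comment> \<open>\<open>N \<ge> 4 / \<delta>\<close> turns the factor \<open>2 / N\<close> into
    \<open>\<delta> / 2\<close>; \<open>N \<le> 5 / \<delta>\<close> makes the copies fit into
    length \<open>w / 4\<close>, which is where 160 = 4 * 5 * 2 * 4 comes from.\<close>
  define N where "N = nat \<lceil>4 / \<delta>\<rceil>"
  have N1: "4 / \<delta> \<le> real N" using \<delta> by (simp add: N_def)
  have "real N \<le> 4 / \<delta> + 1" using \<delta> by (simp add: N_def)
  also have "\<dots> \<le> 5 / \<delta>" using \<delta> by (simp add: field_simps)
  finally have N2: "real N \<le> 5 / \<delta>" .
  have "4 * real d * real N * (2 * z) = real N * (8 * real d * z)" by simp
  also have "\<dots> \<le> 5 / \<delta> * (8 * real d * z)" using N2 z by (intro mult_right_mono) auto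
  also have "\<dots> \<le> w / 4" using z \<delta> by (simp add: field_simps)
  finally have e: "4 * real d * real N * (2 * z) \<le> w / 4" .
  let ?S = "{y\<in>R. g \<le> ip d x y \<and> ip d x y \<le> g + 2 * z}"
  have "real N * measure (vol_space d) ?S \<le> 2 * measure (vol_space d) R"
  proof (cases "g + 2 * z - ip d x a \<ge> w / 4")
    case True
    show ?thesis
      by (rule slab_volume_one_sided[OF R a(1), where e = "g + 2 * z - ip d x a"])
        (use True e z d in auto)
  next
    case False
    have "{y\<in>R. - (g + 2 * z) \<le> ip d (\<lambda>i. - x i) y \<and> ip d (\<lambda>i. - x i) y \<le> - (g + 2 * z) + 2 * z} = ?S"
      by auto
    moreover have "real N * measure (vol_space d)
      {y\<in>R. - (g + 2 * z) \<le> ip d (\<lambda>i. - x i) y \<and> ip d (\<lambda>i. - x i) y \<le> - (g + 2 * z) + 2 * z}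
      \<le> 2 * measure (vol_space d) R"
      by (rule slab_volume_one_sided[OF R a(2), where e = "ip d x a' - g"])
        (use False a(3) e z d in auto)
    ultimately show ?thesis by metis
  qed
  moreover have "4 / \<delta> * measure (vol_space d) ?S \<le> real N * measure (vol_space d) ?S"
    using N1 by (intro mult_right_mono) auto
  ultimately have "4 / \<delta> * measure (vol_space d) ?S \<le> 2 * measure (vol_space d) R" by linarith
  then show ?thesis using \<delta> by (simp add: field_simps)
qed

section \<open>Knowledge sets and their relaxations\<close>

text \<open>A pair \<open>(u, c)\<close> stands for the constraint \<open>\<langle>u, y\<rangle> \<le> c\<close>. Relaxing every constraint
  by \<open>z\<close> plays the role of the Minkowski sum with a ball of radius \<open>z\<close>: the relaxed set contains
  a neighbourhood of the true vector, and it is visibly convex and measurable.\<close>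

definition consistent :: "nat \<Rightarrow> (rvec \<times> real) list \<Rightarrow> rvec set" where
  "consistent d L = {y. ip d y y \<le> 1 \<and> (\<forall>(u, c)\<in>set L. ip d u y \<le> c)}"

text \<open>The cube stands in for the relaxed unit ball: it leaves room 1 in every coordinate
  around the ball, enough for all \<open>z \<le> 1\<close>, and has volume
  \<open>4 ^ d\<close>.\<close>

definition relaxed :: "nat \<Rightarrow> (rvec \<times> real) list \<Rightarrow> real \<Rightarrow> rvec set" where
  "relaxed d L z = {y \<in> {..<d} \<rightarrow>\<^sub>E {-2..2}. \<forall>(u, c)\<in>set L. ip d u y \<le> c + z}"

definition vol :: "nat \<Rightarrow> (rvec \<times> real) list \<Rightarrow> real \<Rightarrow> real" where
  "vol d L z = measure (vol_space d) (relaxed d L z)"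

lemma relaxed_Nil [simp]: "relaxed d [] z = {..<d} \<rightarrow>\<^sub>E {-2..2}"
  by (simp add: relaxed_def)

lemma relaxed_Cons: "relaxed d ((u, c) # L) z = {y \<in> relaxed d L z. ip d u y \<le> c + z}"
  by (auto simp: relaxed_def)

lemma relaxed_sets [measurable]: "relaxed d L z \<in> sets (vol_space d)"
proof (induction L)
  case Nil
  have "({..<d} \<rightarrow>\<^sub>E {-2..2}) \<in> sets (\<Pi>\<^sub>M i\<in>{..<d}. lborel :: real measure)"
    by (intro sets_PiM_I_finite) auto
  then show ?case by (simp add: vol_space_def)
next
  case (Cons p L)
  obtain u c where p: "p = (u, c)" by fastforce
  have "relaxed d (p # L) z = relaxed d L z \<inter> {y \<in> space (vol_space d). ip d u y \<le> c + z}"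
    using sets.sets_into_space[OF Cons] by (auto simp: p relaxed_Cons)
  also have "\<dots> \<in> sets (vol_space d)" using Cons by measurable
  finally show ?case .
qed

lemma emeasure_cube: "emeasure (vol_space d) ({..<d} \<rightarrow>\<^sub>E {-2..2}) = ennreal (4 ^ d)"
  by (subst emeasure_vol_space_PiE) (auto simp flip: ennreal_power)

lemma emeasure_relaxed_le: "emeasure (vol_space d) (relaxed d L z) \<le> ennreal (4 ^ d)"
proof -
  have "relaxed d L z \<subseteq> relaxed d [] z" by (auto simp: relaxed_def)
  then have "emeasure (vol_space d) (relaxed d L z) \<le> emeasure (vol_space d) (relaxed d [] z)"
    by (intro emeasure_mono relaxed_sets)
  then show ?thesis by (simp add: emeasure_cube)
qed

lemma emeasure_relaxed_finite: "emeasure (vol_space d) (relaxed d L z) \<noteq> \<infinity>"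
  using emeasure_relaxed_le[of d L z] by (auto simp: top_unique)

lemma relaxed_fmeasurable: "relaxed d L z \<in> fmeasurable (vol_space d)"
  using emeasure_relaxed_finite[of d L z] by (simp add: fmeasurable_def less_top)

lemma vol_le: "vol d L z \<le> 4 ^ d"
  unfolding vol_def measure_def
  using enn2real_mono[OF emeasure_relaxed_le[of d L z]] by simp

lemma vol_Cons_le: "vol d (p # L) z \<le> vol d L z"
  unfolding vol_def
  by (intro measure_mono_fmeasurable relaxed_fmeasurable relaxed_sets) (auto simp: relaxed_def)

lemma homothety_closed_relaxed: "homothety_closed d (relaxed d L z)"
  unfolding homothety_closed_def
proof (intro ballI)
  fix a y and r :: real assume a: "a \<in> relaxed d L z" and y: "y \<in> relaxed d L z" and r: "r \<in> {0..1}"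
  have conv: "lb \<le> s + r * (t - s) \<and> s + r * (t - s) \<le> ub"
    if "lb \<le> s" "s \<le> ub" "lb \<le> t" "t \<le> ub" for s t lb ub :: real
  proof -
    have eq: "s + r * (t - s) = (1 - r) * s + r * t" by (simp add: algebra_simps)
    have "(1 - r) * lb + r * lb \<le> (1 - r) * s + r * t" "(1 - r) * s + r * t \<le> (1 - r) * ub + r * ub"
      using that r by (auto intro!: add_mono mult_left_mono)
    then show ?thesis unfolding eq by (simp add: algebra_simps)
  qed
  have "homothety d a r y \<in> {..<d} \<rightarrow>\<^sub>E {-2..2}"
    using a y conv[of "-2" _ 2] by (auto simp: homothety_def relaxed_def PiE_iff)
  moreover have "ip d u (homothety d a r y) \<le> c + z" if "(u, c) \<in> set L" for u c
  proof -
    have "ip d u a \<le> c + z" "ip d u y \<le> c + z" using a y that by (auto simp: relaxed_def)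
    then show ?thesis
      using conv[of "min (ip d u a) (ip d u y)" "ip d u a" "c + z" "ip d u y"] by simp
  qed
  ultimately show "homothety d a r y \<in> relaxed d L z" by (auto simp: relaxed_def)
qed

lemma abs_le_1_if_ip_le_1:
  assumes "ip d y y \<le> 1" "i < d"
  shows "\<bar>y i\<bar> \<le> 1"
proof -
  have "y i * y i \<le> ip d y y"
    unfolding ip_def using assms(2) by (intro member_le_sum) auto
  then show ?thesis using assms(1) by (simp add: abs_square_le_1[symmetric] power2_eq_square)
qed

lemma restrict_in_relaxed:
  assumes "y \<in> consistent d L" "0 \<le> z"
  shows "restrict y {..<d} \<in> relaxed d L z"
proof -
  have "y i \<in> {-2..2}" if "i < d" for i
    using abs_le_1_if_ip_le_1[of d y i] assms(1) that by (auto simp: consistent_def)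
  moreover have "ip d u y \<le> c + z" if "(u, c) \<in> set L" for u c
    using assms that by (fastforce simp: consistent_def)
  ultimately show ?thesis by (auto simp: relaxed_def)
qed

text \<open>The box of half side \<open>z / d\<close> around \<open>y\<close> fits: each coordinate
  of a constraint vector is at most 1 in absolute value, so moving inside the box changes an inner
  product by at most \<open>d * (z / d) = z\<close>.\<close>

lemma vol_ge:
  assumes y: "y \<in> consistent d L" and L: "\<And>u c. (u, c) \<in> set L \<Longrightarrow> ip d u u \<le> 1"
    and z: "0 < z" "z \<le> 1" and d: "d > 0"
  shows "(2 * z / real d) ^ d \<le> vol d L z"
proof -
  let ?h = "z / real d"
  let ?B = "Pi\<^sub>E {..<d} (\<lambda>i. {y i - ?h..y i + ?h})"
  have h: "0 < ?h" "?h \<le> 1" using z d by (auto simp: field_simps) 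
  have sub: "?B \<subseteq> relaxed d L z"
  proof
    fix v assume v: "v \<in> ?B"
    have vy: "\<bar>v i - y i\<bar> \<le> ?h" if "i < d" for i
      using PiE_mem[OF v, of i] that by auto
    have "v i \<in> {-2..2}" if "i < d" for i
    proof -
      have "\<bar>y i\<bar> \<le> 1" using abs_le_1_if_ip_le_1[of d y i] y that by (simp add: consistent_def)
      then have "-2 \<le> v i" "v i \<le> 2" using vy[OF that] h(2) by (simp_all only: abs_le_iff) linarith+
      then show ?thesis by simp
    qed
    then have "v \<in> {..<d} \<rightarrow>\<^sub>E {-2..2}" using v by (auto simp: PiE_iff)
    moreover have "ip d u v \<le> c + z" if uc: "(u, c) \<in> set L" for u c
    proof -
      have "ip d u v - ip d u y = (\<Sum>i<d. u i * (v i - y i))"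
        by (simp add: ip_def sum_subtractf algebra_simps)
      also have "\<dots> \<le> (\<Sum>i<d. ?h)"
      proof (rule sum_mono)
        fix i assume i: "i \<in> {..<d}"
        have "\<bar>u i * (v i - y i)\<bar> \<le> 1 * ?h"
          unfolding abs_mult using abs_le_1_if_ip_le_1[OF L[OF uc]] vy i by (intro mult_mono) auto
        then show "u i * (v i - y i) \<le> ?h" by simp
      qed
      also have "\<dots> = z" using d by simp
      finally have "ip d u v \<le> ip d u y + z" by simp
      moreover have "ip d u y \<le> c" using y uc by (auto simp: consistent_def)
      ultimately show ?thesis by linarith
    qed
    ultimately show "v \<in> relaxed d L z" by (auto simp: relaxed_def)
  qed
  have B: "emeasure (vol_space d) ?B = ennreal ((2 * z / real d) ^ d)"
    using h by (subst emeasure_vol_space_PiE) (auto simp: ennreal_power)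
  have "?B \<in> sets (\<Pi>\<^sub>M i\<in>{..<d}. lborel :: real measure)"
    by (intro sets_PiM_I_finite) auto
  then have "measure (vol_space d) ?B \<le> vol d L z"
    unfolding vol_def using sub
    by (intro measure_mono_fmeasurable relaxed_fmeasurable) (auto simp: vol_space_def)
  then show ?thesis using B z by (simp add: measure_def)
qed

section \<open>Intervals for the valuations\<close>

definition lo :: "nat \<Rightarrow> (rvec \<times> real) list \<Rightarrow> rvec \<Rightarrow> real" where
  "lo d L x = Inf (ip d x ` consistent d L)"

definition hi :: "nat \<Rightarrow> (rvec \<times> real) list \<Rightarrow> rvec \<Rightarrow> real" where
  "hi d L x = - lo d L (\<lambda>i. - x i)"

lemma abs_ip_le_1:
  assumes "ip d x x \<le> 1" "ip d y y \<le> 1"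
  shows "\<bar>ip d x y\<bar> \<le> 1"
proof -
  have "(ip d x y)\<^sup>2 \<le> ip d x x * ip d y y"
    using Cauchy_Schwarz_ineq_sum[of x y "{..<d}"] by (simp add: ip_def power2_eq_square)
  also have "\<dots> \<le> 1 * 1" using assms by (intro mult_mono) (auto simp: ip_def intro!: sum_nonneg)
  finally show ?thesis by (simp add: abs_square_le_1)
qed

lemma ip_uminus_right [simp]: "ip d x (\<lambda>i. - y i) = - ip d x y"
  by (simp add: ip_def sum_negf)

lemma lo_le:
  assumes "ip d x x \<le> 1" "y \<in> consistent d L"
  shows "lo d L x \<le> ip d x y"
  unfolding lo_def
proof (rule cInf_lower)
  show "bdd_below (ip d x ` consistent d L)"
    using abs_ip_le_1[OF assms(1)] by (force simp: consistent_def intro!: bdd_belowI[of _ "-1"])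
qed (use assms in auto)

lemma le_hi:
  assumes "ip d x x \<le> 1" "y \<in> consistent d L"
  shows "ip d x y \<le> hi d L x"
  using lo_le[of d "\<lambda>i. - x i" y L] assms by (simp add: hi_def)

lemma lo_ge:
  assumes "ip d x x \<le> 1" "consistent d L \<noteq> {}"
  shows "- 1 \<le> lo d L x"
  unfolding lo_def using abs_ip_le_1[OF assms(1)] assms(2)
  by (intro cInf_greatest) (force simp: consistent_def)+

lemma hi_le:
  assumes "ip d x x \<le> 1" "consistent d L \<noteq> {}"
  shows "hi d L x \<le> 1"
  using lo_ge[of d "\<lambda>i. - x i" L] assms by (simp add: hi_def)

lemma lo_approx:
  assumes "consistent d L \<noteq> {}" "\<epsilon> > 0"
  obtains y where "y \<in> consistent d L" "ip d x y < lo d L x + \<epsilon>"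
  using assms cInf_lessD[of "ip d x ` consistent d L" "lo d L x + \<epsilon>"] by (auto simp: lo_def)

text \<open>Points within a quarter of the width of either end still differ by half of the width, so
  attainment of the infima is not at issue.\<close>

lemma width_witnesses:
  assumes "consistent d L \<noteq> {}" "lo d L x < hi d L x"
  obtains a a' where "a \<in> consistent d L" "a' \<in> consistent d L"
    "(hi d L x - lo d L x) / 2 \<le> ip d x a' - ip d x a"
proof -
  let ?e = "(hi d L x - lo d L x) / 4"
  obtain a where a: "a \<in> consistent d L" "ip d x a < lo d L x + ?e"
    using lo_approx[of d L ?e x] assms by auto
  obtain a' where a': "a' \<in> consistent d L" "- ip d x a' < lo d L (\<lambda>i. - x i) + ?e"
    using lo_approx[of d L ?e "\<lambda>i. - x i"] assms by auto
  show ?thesis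
    by (rule that[OF a(1) a'(1)]) (use a(2) a'(2) in \<open>simp add: hi_def field_simps\<close>)
qed

section \<open>Cuts and their effect on the relaxed volume\<close>

definition good_cut :: "nat \<Rightarrow> (rvec \<times> real) list \<Rightarrow> rvec \<Rightarrow> real \<Rightarrow> real \<Rightarrow> real \<Rightarrow> bool" where
  "good_cut d L x z \<delta> c \<longleftrightarrow>
     vol d (((\<lambda>i. - x i), - c) # L) z \<le> (1 - \<delta> / 2) * vol d L z \<and>
     vol d ((x, c) # L) z \<le> 2 * \<delta> * vol d L z"

text \<open>Scan a grid of step \<open>z\<close> and let \<open>c\<close> be the first point with at
  least a fraction \<open>\<delta>\<close> of the volume below it; this replaces a continuity
  argument. Relaxation moves the cut by \<open>z\<close> either way, and the slab between
  \<open>c - z\<close> and \<open>c + z\<close> holds at most \<open>\<delta> / 2\<close>. So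
  acceptance removes at least \<open>\<delta> / 2\<close>, and rejection keeps at most
  \<open>3 * \<delta> / 2\<close>.\<close>

lemma good_cut_exists:
  assumes K: "consistent d L \<noteq> {}" and V: "vol d L z > 0"
    and w: "w \<le> hi d L x - lo d L x"
    and z: "z > 0" "160 * real d * z \<le> \<delta> * w" and \<delta>: "0 < \<delta>" "\<delta> \<le> 1" and d: "d > 0"
  shows "\<exists>c. good_cut d L x z \<delta> c"
proof -
  let ?M = "vol_space d" and ?R = "relaxed d L z"
  have "0 < 160 * real d * z" using z d by simp
  then have "0 < \<delta> * w" using z by linarith
  then have w0: "w > 0" using \<delta> by (simp add: zero_less_mult_iff)
  obtain a a' where aa: "a \<in> consistent d L" "a' \<in> consistent d L"
      "(hi d L x - lo d L x) / 2 \<le> ip d x a' - ip d x a"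
    using width_witnesses[OF K, of x] w w0 by auto
  have slab: "measure ?M {y\<in>?R. g \<le> ip d x y \<and> ip d x y \<le> g + 2 * z} \<le> \<delta> / 2 * vol d L z" for g
    unfolding vol_def
    by (rule slab_volume[where a = "restrict a {..<d}" and a' = "restrict a' {..<d}" and w = w])
      (use aa w z \<delta> d emeasure_relaxed_finite[of d L z]
        in \<open>auto intro: restrict_in_relaxed homothety_closed_relaxed relaxed_sets\<close>)
  have meas: "{y\<in>?R. P (ip d x y)} \<in> fmeasurable ?M" if "Measurable.pred borel P" for P
  proof -
    have "{y\<in>?R. P (ip d x y)} = ?R \<inter> {y\<in>space ?M. P (ip d x y)}"
      using sets.sets_into_space[OF relaxed_sets[of d L z]] by auto
    also have "\<dots> \<in> sets ?M" using that by measurable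
    finally have "{y\<in>?R. P (ip d x y)} \<in> sets ?M" .
    then show ?thesis by (intro fmeasurableI2[OF relaxed_fmeasurable[of d L z]]) auto
  qed
  \<comment> \<open>A strict bound on the inner products over the cube: the grid starts below the
    whole relaxed set, so \<open>F 0 = 0\<close> and the least index has a predecessor.\<close>
  define b where "b = 2 * (\<Sum>i<d. \<bar>x i\<bar>) + 1"
  have bound: "\<bar>ip d x y\<bar> < b" if "y \<in> ?R" for y
  proof -
    have "\<bar>ip d x y\<bar> \<le> (\<Sum>i<d. \<bar>x i * y i\<bar>)" unfolding ip_def by (rule sum_abs)
    also have "\<dots> \<le> (\<Sum>i<d. 2 * \<bar>x i\<bar>)"
    proof (rule sum_mono)
      fix i assume "i \<in> {..<d}"
      then have "\<bar>y i\<bar> \<le> 2" using that by (force simp: relaxed_def PiE_iff)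
      then have "\<bar>x i\<bar> * \<bar>y i\<bar> \<le> \<bar>x i\<bar> * 2" by (intro mult_left_mono) auto
      then show "\<bar>x i * y i\<bar> \<le> 2 * \<bar>x i\<bar>" by (simp add: abs_mult)
    qed
    finally show ?thesis by (simp add: b_def sum_distrib_left)
  qed
  define F where "F n = measure ?M {y\<in>?R. ip d x y \<le> real n * z - b}" for n
  obtain n where n: "2 * b / z < real n" using reals_Archimedean2 by blast
  have "{y\<in>?R. ip d x y \<le> real n * z - b} = ?R"
    using bound n z by (fastforce simp: field_simps)
  then have "\<delta> * vol d L z \<le> F n" using \<delta> V by (simp add: F_def vol_def)
  then have ex: "\<exists>n. \<delta> * vol d L z \<le> F n" ..
  define m where "m = (LEAST n. \<delta> * vol d L z \<le> F n)"
  have m1: "\<delta> * vol d L z \<le> F m" unfolding m_def using ex by (rule LeastI_ex)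
  have "{y\<in>?R. ip d x y \<le> real 0 * z - b} = {}" using bound by fastforce
  then have "F 0 = 0" unfolding F_def by (simp only: measure_empty)
  then have "m \<noteq> 0" using m1 mult_pos_pos[OF \<delta>(1) V] by (intro notI) simp
  then obtain k where k: "m = Suc k" by (cases m) auto
  have m2: "F k < \<delta> * vol d L z" using not_less_Least[of k "\<lambda>n. \<delta> * vol d L z \<le> F n"]
    by (auto simp: k m_def[symmetric])
  define c where "c = real m * z - b"
  have kc: "real k * z - b = c - z" by (simp add: c_def k algebra_simps)
  let ?slab = "{y\<in>?R. c - z \<le> ip d x y \<and> ip d x y \<le> (c - z) + 2 * z}"
  have "F m \<le> measure ?M ({y\<in>?R. ip d x y < c - z} \<union> ?slab)"
    unfolding F_def c_def[symmetric] using z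
    by (intro measure_mono_fmeasurable fmeasurable.Un fmeasurableD meas) auto
  also have "\<dots> \<le> measure ?M {y\<in>?R. ip d x y < c - z} + measure ?M ?slab"
    by (intro measure_Un_le fmeasurableD meas) auto
  finally have low: "\<delta> / 2 * vol d L z \<le> measure ?M {y\<in>?R. ip d x y < c - z}"
    using slab[of "c - z"] m1 by (simp add: field_simps)
  have "relaxed d ((\<lambda>i. - x i, - c) # L) z = ?R - {y\<in>?R. ip d x y < c - z}"
    by (auto simp: relaxed_Cons)
  then have "vol d ((\<lambda>i. - x i, - c) # L) z = vol d L z - measure ?M {y\<in>?R. ip d x y < c - z}"
    unfolding vol_def using meas[of "\<lambda>t. t < c - z"] relaxed_sets[of d L z] emeasure_relaxed_finite[of d L z]
    by (auto intro!: measure_Diff)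
  then have 1: "vol d ((\<lambda>i. - x i, - c) # L) z \<le> (1 - \<delta> / 2) * vol d L z"
    using low by (simp add: algebra_simps)
  have "vol d ((x, c) # L) z \<le> measure ?M ({y\<in>?R. ip d x y \<le> c - z} \<union> ?slab)"
    unfolding vol_def relaxed_Cons using z
    by (intro measure_mono_fmeasurable fmeasurable.Un fmeasurableD meas) auto
  also have "\<dots> \<le> F k + measure ?M ?slab"
    unfolding F_def kc by (intro measure_Un_le fmeasurableD meas) auto
  also have "\<dots> \<le> \<delta> * vol d L z + \<delta> / 2 * vol d L z" using m2 slab[of "c - z"] by linarith
  also have "\<dots> \<le> 2 * \<delta> * vol d L z" using \<delta> V by (simp add: field_simps)
  finally show ?thesis using 1 unfolding good_cut_def by blast
qed

definition cut :: "nat \<Rightarrow> (rvec \<times> real) list \<Rightarrow> rvec \<Rightarrow> real \<Rightarrow> real \<Rightarrow> real" where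
  "cut d L x z \<delta> = (SOME c. good_cut d L x z \<delta> c)"

definition ask :: "nat \<Rightarrow> (rvec \<times> real) list \<Rightarrow> rvec \<Rightarrow> real \<Rightarrow> real \<Rightarrow> real" where
  "ask d L x z \<delta> = (let c = cut d L x z \<delta> in if lo d L x \<le> c \<and> c \<le> hi d L x then c else lo d L x)"

text \<open>The cut is chosen for the relaxed set, so it may miss the interval \<open>[lo, hi]\<close>. Then it is
  already implied for the true vector; adding it teaches nothing about that vector but still
  shrinks the relaxed volume, so the safe price \<open>lo\<close> is posted.\<close>

definition learn :: "nat \<Rightarrow> (rvec \<times> real) list \<Rightarrow> rvec \<Rightarrow> real \<Rightarrow> real \<Rightarrow> bool \<Rightarrow> (rvec \<times> real) list" where
  "learn d L x z \<delta> acc = (let c = cut d L x z \<delta> in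
     if c < lo d L x \<or> acc \<and> c \<le> hi d L x then ((\<lambda>i. - x i), - c) # L else (x, c) # L)"

definition wf_constraints :: "nat \<Rightarrow> (rvec \<times> real) list \<Rightarrow> bool" where
  "wf_constraints d L \<longleftrightarrow> (\<forall>(u, c)\<in>set L. ip d u u \<le> 1)"

lemma vol_pos:
  assumes "y \<in> consistent d L" "wf_constraints d L" "0 < z" "z \<le> 1" "d > 0"
  shows "vol d L z > 0"
proof -
  have "0 < (2 * z / real d) ^ d" using assms by simp
  also have "\<dots> \<le> vol d L z" using assms by (intro vol_ge) (auto simp: wf_constraints_def)
  finally show ?thesis .
qed

lemma vol_learn_le: "vol d (learn d L x z \<delta> acc) z' \<le> vol d L z'"
  by (simp add: learn_def Let_def vol_Cons_le)

lemma wf_learn: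
  assumes "wf_constraints d L" "ip d x x \<le> 1"
  shows "wf_constraints d (learn d L x z \<delta> acc)"
  using assms by (auto simp: learn_def Let_def wf_constraints_def)

lemma ask_bounds:
  assumes "ip d x x \<le> 1" "y \<in> consistent d L"
  shows "lo d L x \<le> ask d L x z \<delta>" "ask d L x z \<delta> \<le> hi d L x"
  using lo_le[OF assms] le_hi[OF assms] by (auto simp: ask_def Let_def)

lemma consistent_learn:
  assumes "ip d x x \<le> 1" "y \<in> consistent d L"
  shows "y \<in> consistent d (learn d L x z \<delta> (ask d L x z \<delta> \<le> ip d x y))"
  using lo_le[OF assms] le_hi[OF assms] assms(2)
  by (auto simp: consistent_def learn_def ask_def Let_def split: if_splits)

text \<open>When the cut misses the interval, \<open>lo\<close> is posted and surely accepted. If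
  the cut lay above \<open>hi\<close>, the rejection constraint is added all the same; its factor
  \<open>2 * \<delta>\<close> is below \<open>1 - \<delta> / 2\<close> because
  \<open>\<delta> \<le> 1/4\<close>.\<close>

lemma vol_learn:
  assumes x: "ip d x x \<le> 1" and y: "y \<in> consistent d L" and V: "vol d L z > 0"
    and w: "w \<le> hi d L x - lo d L x"
    and z: "z > 0" "160 * real d * z \<le> \<delta> * w" and \<delta>: "0 < \<delta>" "\<delta> \<le> 1/4" and d: "d > 0"
  shows "vol d (learn d L x z \<delta> (ask d L x z \<delta> \<le> ip d x y)) z
    \<le> (if ask d L x z \<delta> \<le> ip d x y then 1 - \<delta> / 2 else 2 * \<delta>) * vol d L z"
proof -
  let ?c = "cut d L x z \<delta>"
  have "\<exists>c. good_cut d L x z \<delta> c"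
    using y by (intro good_cut_exists[OF _ V w z]) (use \<delta> d in auto)
  then have "good_cut d L x z \<delta> ?c" unfolding cut_def by (rule someI_ex)
  then have c: "vol d ((\<lambda>i. - x i, - ?c) # L) z \<le> (1 - \<delta> / 2) * vol d L z"
      "vol d ((x, ?c) # L) z \<le> 2 * \<delta> * vol d L z"
    by (auto simp: good_cut_def)
  have "2 * \<delta> * vol d L z \<le> (1 - \<delta> / 2) * vol d L z"
    using \<delta> V by (intro mult_right_mono) auto
  then have c': "vol d ((x, ?c) # L) z \<le> (1 - \<delta> / 2) * vol d L z" using c(2) by linarith
  show ?thesis
    using c c' lo_le[OF x y] by (auto simp: learn_def ask_def Let_def split: if_splits)
qed

section \<open>Scales\<close>

text \<open>\<open>Overlap k\<close> handles widths in \<open>(1 / 2 ^ k, 2 / 2 ^ k]\<close>, and \<open>Separated i\<close> handles widths in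
  \<open>(8 v\<^sup>4, 8 v\<^sup>2]\<close> for \<open>v = 1 / 2 ^ 2 ^ i\<close>. The slack is the largest one for which
  \<open>160 d \<cdot> slack \<le> quota \<cdot> width\<close>, as the slab bound requires. The weight is chosen so that the drop
  of the weighted logarithmic volume pays for a round: with quota \<open>\<delta>\<close>, an accepted price drops the
  logarithm by \<open>\<delta>/2\<close> and must pay twice the width; a rejected one drops it by \<open>ln (1/(2\<delta>))\<close> and
  must pay \<open>2\<close> (\<open>Separated\<close>) or twice the width (\<open>Overlap\<close>).\<close>

datatype level = Overlap nat | Separated nat

fun slack :: "nat \<Rightarrow> level \<Rightarrow> real" where
  "slack d (Overlap k) = 1 / (640 * real d * 2 ^ k)"
| "slack d (Separated i) = 1 / (80 * real d * (2 ^ 2 ^ i) ^ 5)"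

fun quota :: "level \<Rightarrow> real" where
  "quota (Overlap k) = 1 / 4"
| "quota (Separated i) = 1 / (4 * 2 ^ 2 ^ i)"

fun weight :: "level \<Rightarrow> real" where
  "weight (Overlap k) = 32 / 2 ^ k"
| "weight (Separated i) = 128 / 2 ^ 2 ^ i + 4 / 2 ^ i"

definition level_of :: "bool \<Rightarrow> real \<Rightarrow> level" where
  "level_of sep w = (if sep then Separated (LEAST i. 8 / (2 ^ 2 ^ i) ^ 4 < w)
     else Overlap (LEAST k. 1 / 2 ^ k < w))"

lemma weight_nonneg: "weight l \<ge> 0"
  by (cases l) auto

lemma slack_pos: "d > 0 \<Longrightarrow> slack d l > 0"
  by (cases l) auto

lemma slack_le_1:
  assumes "d > 0"
  shows "slack d l \<le> 1"
proof (cases l)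
  case (Overlap k)
  have "1 * 1 * 1 \<le> (640::real) * real d * 2 ^ k" using assms by (intro mult_mono) auto
  then show ?thesis using Overlap by (simp add: divide_le_eq_1)
next
  case (Separated i)
  have "1 * 1 * 1 \<le> (80::real) * real d * (2 ^ 2 ^ i) ^ 5"
    using assms by (intro mult_mono one_le_power) auto
  then show ?thesis using Separated by (simp add: divide_le_eq_1)
qed

lemma quota_pos: "quota l > 0"
  by (cases l) auto

lemma quota_le: "quota l \<le> 1 / 4"
  by (cases l) (auto simp: field_simps)

lemma ex_overlap_level:
  fixes w :: real assumes "w > 0"
  shows "\<exists>k. 1 / 2 ^ k < w"
  using real_arch_pow_inv[of w "1/2"] assms by (auto simp: power_one_over)

lemma ex_separated_level:
  fixes w :: real assumes "w > 0"
  shows "\<exists>i. 8 / (2 ^ 2 ^ i) ^ 4 < w"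
proof -
  obtain k where k: "1 / 2 ^ k < w / 8" using ex_overlap_level[of "w / 8"] assms by auto
  have "(2::real) ^ k \<le> 2 ^ (2 ^ k * 4)"
  proof (rule power_increasing)
    have "k < 2 ^ k" by (rule less_exp)
    then show "k \<le> 2 ^ k * 4" by linarith
  qed simp
  then have "8 / (2 ^ 2 ^ k) ^ 4 \<le> 8 / (2::real) ^ k"
    by (intro divide_left_mono) (auto simp: power_mult[symmetric])
  also have "\<dots> < w" using k by simp
  finally show ?thesis by blast
qed

lemma level_of_overlap:
  assumes "0 < w" "w \<le> 2"
  obtains k where "level_of False w = Overlap k" "1 / 2 ^ k < w" "w \<le> 2 / 2 ^ k"
proof -
  define k where "k = (LEAST k. 1 / 2 ^ k < w)"
  have 1: "1 / 2 ^ k < w" unfolding k_def using ex_overlap_level[OF assms(1)] by (rule LeastI_ex)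
  have "w \<le> 2 / 2 ^ k"
  proof (cases k)
    case (Suc j)
    then have "\<not> 1 / 2 ^ j < w" using not_less_Least[of j "\<lambda>k. 1 / 2 ^ k < w"] by (auto simp: k_def)
    then show ?thesis by (simp add: Suc)
  qed (use assms in simp)
  with 1 show ?thesis by (intro that[of k]) (auto simp: level_of_def k_def)
qed

text \<open>Since \<open>v\<close> is squared from one level to the next, the lower end
  \<open>8 / v^4\<close> of a range is the upper end \<open>8 / v^2\<close> of the next; at
  \<open>i = 0\<close> the upper end is 2, the largest width.\<close>

lemma level_of_separated:
  assumes "0 < w" "w \<le> 2"
  obtains i where "level_of True w = Separated i" "8 / (2 ^ 2 ^ i) ^ 4 < w" "w \<le> 8 / (2 ^ 2 ^ i) ^ 2"
proof -
  define i where "i = (LEAST i. 8 / (2 ^ 2 ^ i) ^ 4 < w)"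
  have 1: "8 / (2 ^ 2 ^ i) ^ 4 < w"
    unfolding i_def using ex_separated_level[OF assms(1)] by (rule LeastI_ex)
  have "w \<le> 8 / (2 ^ 2 ^ i) ^ 2"
  proof (cases i)
    case (Suc j)
    then have "\<not> 8 / (2 ^ 2 ^ j) ^ 4 < w"
      using not_less_Least[of j "\<lambda>i. 8 / (2 ^ 2 ^ i) ^ 4 < w"] by (auto simp: i_def)
    moreover have "((2::real) ^ 2 ^ Suc j) ^ 2 = (2 ^ 2 ^ j) ^ 4"
      by (simp flip: power_mult)
    ultimately show ?thesis by (simp only: Suc not_less)
  qed (use assms in simp)
  with 1 show ?thesis by (intro that[of i]) (auto simp: level_of_def i_def)
qed

lemma slack_level_of:
  assumes "0 < w" "w \<le> 2" "d > 0"
  shows "160 * real d * slack d (level_of sep w) \<le> quota (level_of sep w) * w"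
proof (cases sep)
  case True
  obtain i where i: "level_of True w = Separated i" "8 / (2 ^ 2 ^ i) ^ 4 < w" "w \<le> 8 / (2 ^ 2 ^ i) ^ 2"
    using level_of_separated[OF assms(1,2)] .
  define v :: real where "v = 2 ^ 2 ^ i"
  have v: "v > 0" by (simp add: v_def)
  have "160 * real d * slack d (Separated i) = 1 / (4 * v) * (8 / v ^ 4)"
    using assms(3) by (simp add: v_def[symmetric] power_numeral_reduce)
  also have "\<dots> \<le> 1 / (4 * v) * w"
    using i(2) v unfolding v_def[symmetric] by (intro mult_left_mono) auto
  finally show ?thesis using True i(1) by (simp add: v_def)
next
  case False
  obtain k where k: "level_of False w = Overlap k" "1 / 2 ^ k < w" "w \<le> 2 / 2 ^ k"
    using level_of_overlap[OF assms(1,2)] .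
  have "160 * real d * slack d (Overlap k) = 1 / 4 * (1 / 2 ^ k)" using assms(3) by simp
  also have "\<dots> \<le> 1 / 4 * w" using k(2) by (intro mult_left_mono) auto
  finally show ?thesis using False k(1) by simp
qed

section \<open>The potential and its drop in a probing round\<close>

definition potential :: "nat \<Rightarrow> level set \<Rightarrow> (rvec \<times> real) list \<Rightarrow> real" where
  "potential d \<Lambda> L = (\<Sum>l\<in>\<Lambda>. weight l * ln (vol d L (slack d l)))"

lemma vol_slack_pos:
  assumes "y \<in> consistent d L" "wf_constraints d L" "d > 0"
  shows "vol d L (slack d l) > 0"
  using assms by (intro vol_pos) (auto intro: slack_pos slack_le_1)

text \<open>Every volume lies between \<open>(2 * z / d) ^ d\<close> and \<open>4 ^ d\<close>; the
  logarithm of the quotient of these bounds is \<open>d * ln (2 * d / z)\<close>.\<close>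

lemma potential_range:
  assumes "y \<in> consistent d L" "wf_constraints d L" "d > 0"
  shows "potential d \<Lambda> [] - potential d \<Lambda> L \<le> (\<Sum>l\<in>\<Lambda>. weight l * (real d * ln (2 * real d / slack d l)))"
proof -
  have *: "ln (vol d [] (slack d l)) - ln (vol d L (slack d l)) \<le> real d * ln (2 * real d / slack d l)" for l
  proof -
    let ?z = "slack d l"
    have z: "?z > 0" using assms(3) by (rule slack_pos)
    have "vol d [] ?z > 0"
      using assms by (intro vol_slack_pos[of y]) (auto simp: consistent_def wf_constraints_def)
    then have "ln (vol d [] ?z) \<le> ln (4 ^ d)" using vol_le[of d "[]" ?z] by simp
    moreover have "ln ((2 * ?z / real d) ^ d) \<le> ln (vol d L ?z)"
    proof (subst ln_le_cancel_iff)
      show "(2 * ?z / real d) ^ d \<le> vol d L ?z"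
        using assms slack_pos slack_le_1 by (intro vol_ge) (auto simp: wf_constraints_def)
    qed (use assms z vol_slack_pos in auto)
    moreover have "ln (4 ^ d) - ln ((2 * ?z / real d) ^ d) = real d * ln (2 * real d / ?z)"
    proof -
      have "ln (4 ^ d) - ln ((2 * ?z / real d) ^ d) = real d * (ln 4 - ln (2 * ?z / real d))"
        using z assms(3) by (simp add: ln_realpow algebra_simps)
      also have "ln 4 - ln (2 * ?z / real d) = ln (4 / (2 * ?z / real d))"
        using z assms(3) by (subst ln_div) auto
      also have "4 / (2 * ?z / real d) = 2 * real d / ?z" by simp
      finally show ?thesis .
    qed
    ultimately show ?thesis by linarith
  qed
  show ?thesis
    unfolding potential_def sum_subtractf[symmetric] right_diff_distrib[symmetric]
    by (intro sum_mono mult_left_mono * weight_nonneg)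
qed

lemma potential_antimono:
  assumes "y \<in> consistent d L'" "wf_constraints d L'" "d > 0" "\<And>z. vol d L' z \<le> vol d L z"
  shows "potential d \<Lambda> L' \<le> potential d \<Lambda> L"
  unfolding potential_def
  using vol_slack_pos[OF assms(1-3)] assms(4)
  by (intro sum_mono mult_left_mono weight_nonneg) (metis ln_mono)

text \<open>A new constraint raises no term of the potential, so the drop at the probed level alone
  is a lower bound.\<close>

lemma potential_drop:
  assumes "y \<in> consistent d L'" "wf_constraints d L'" "d > 0" "\<And>z. vol d L' z \<le> vol d L z"
    and \<Lambda>: "finite \<Lambda>" "l \<in> \<Lambda>" and r: "vol d L' (slack d l) \<le> r * vol d L (slack d l)" "r > 0"
  shows "weight l * (- ln r) \<le> potential d \<Lambda> L - potential d \<Lambda> L'"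
proof -
  have V': "vol d L' (slack d l) > 0" for l using vol_slack_pos[OF assms(1-3)] .
  then have V: "vol d L (slack d l) > 0" for l using assms(4) by (metis less_le_trans)
  let ?D = "\<lambda>l. weight l * (ln (vol d L (slack d l)) - ln (vol d L' (slack d l)))"
  have "ln (vol d L' (slack d l)) \<le> ln (r * vol d L (slack d l))"
    using r V' by (metis ln_mono)
  also have "\<dots> = ln r + ln (vol d L (slack d l))" using r V[of l] by (simp add: ln_mult_pos)
  finally have "weight l * (- ln r) \<le> ?D l" by (intro mult_left_mono weight_nonneg) simp
  also have "\<dots> \<le> sum ?D \<Lambda>"
  proof (rule member_le_sum)
    fix l' show "0 \<le> ?D l'"
      using V'[of l'] V[of l'] assms(4)[of "slack d l'"] by (intro mult_nonneg_nonneg weight_nonneg) auto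
  qed (use \<Lambda> in auto)
  also have "\<dots> = potential d \<Lambda> L - potential d \<Lambda> L'"
    by (simp add: potential_def sum_subtractf right_diff_distrib)
  finally show ?thesis .
qed

lemma weight_level_of:
  fixes sep :: bool and w :: real
  assumes "0 < w" "w \<le> 2"
  defines "l \<equiv> level_of sep w"
  shows "2 * w \<le> weight l * (- ln (1 - quota l / 2))"
    and "(if sep then 2 else 2 * w) \<le> weight l * (- ln (2 * quota l))"
proof -
  have "ln (1 - quota l / 2) \<le> - (quota l / 2)"
    using quota_le[of l] ln_le_minus_one[of "1 - quota l / 2"] by simp
  then have "weight l * (quota l / 2) \<le> weight l * (- ln (1 - quota l / 2))"
    by (intro mult_left_mono weight_nonneg) simp
  moreover have "2 * w \<le> weight l * (quota l / 2) \<and>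
    (if sep then 2 else 2 * w) \<le> weight l * (- ln (2 * quota l))"
  proof (cases sep)
    case True
    obtain i where i: "level_of True w = Separated i" "w \<le> 8 / (2 ^ 2 ^ i) ^ 2"
      using level_of_separated[OF assms(1,2)] .
    have l: "l = Separated i" using i True by (simp add: l_def)
    define v :: real where "v = 2 ^ 2 ^ i"
    have v: "v > 0" by (simp add: v_def)
    \<comment> \<open>The first summand of the weight pays for acceptance: 128/v * 1/(8v) = 16/v^2,
      and \<open>w \<le> 8 / v^2\<close>.\<close>
    have "2 * w \<le> 128 / v * (1 / (4 * v) / 2)"
      using i(2) by (simp add: v_def[symmetric] power2_eq_square)
    also have "\<dots> \<le> (128 / v + 4 / 2 ^ i) * (1 / (4 * v) / 2)"
      using v by (intro mult_right_mono) auto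
    finally have 1: "2 * w \<le> weight l * (quota l / 2)" by (simp add: l v_def)
    have "- ln (2 * quota l) = ln (2 * v)"
      using v by (simp add: l v_def[symmetric] ln_div ln_mult_pos)
    also have "\<dots> \<ge> ln v" using v by simp
    also have "ln v = 2 ^ i * ln 2" by (simp add: v_def ln_realpow)
    finally have "weight l * (2 ^ i * ln 2) \<le> weight l * (- ln (2 * quota l))"
      by (intro mult_left_mono weight_nonneg)
    \<comment> \<open>The second summand pays for rejection: the logarithmic drop is at least
      \<open>2 ^ i * ln 2\<close>, which cancels the decay of \<open>4 / 2 ^ i\<close>.\<close>
    moreover have "4 / 2 ^ i * (2 ^ i * ln 2) \<le> weight l * (2 ^ i * ln (2::real))"
      by (intro mult_right_mono) (auto simp: l)
    moreover have "2 \<le> 4 / 2 ^ i * (2 ^ i * ln (2::real))" using ln2_ge_two_thirds by simp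
    ultimately have "2 \<le> weight l * (- ln (2 * quota l))" by linarith
    then show ?thesis using 1 True by simp
  next
    case False
    obtain k where k: "level_of False w = Overlap k" "w \<le> 2 / 2 ^ k"
      using level_of_overlap[OF assms(1,2)] .
    have l: "l = Overlap k" using k False by (simp add: l_def)
    have "- ln (2 * quota l) = ln 2" by (simp add: l ln_div)
    then have "32 / 2 ^ k * (1 / 8) \<le> weight l * (- ln (2 * quota l))"
      using ln2_ge_two_thirds by (simp only: l weight.simps) (intro mult_left_mono, auto)
    then show ?thesis using k(2) False by (auto simp: l)
  qed
  ultimately show "2 * w \<le> weight l * (- ln (1 - quota l / 2))"
    and "(if sep then 2 else 2 * w) \<le> weight l * (- ln (2 * quota l))"
    by auto
qed

text \<open>One probe, stated for the buyer's side. Monotonicity holds for any set of levels, the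
  payment only if the set contains the probed level; a round at a separated level thus leaves the
  overlap potential at worst unchanged.\<close>

lemma probe_progress:
  fixes sep :: bool and w :: real
  assumes x: "ip d x x \<le> 1" and y: "y \<in> consistent d L" and L: "wf_constraints d L"
    and w: "w = hi d L x - lo d L x" "0 < w" and d: "d > 0"
  defines "l \<equiv> level_of sep w"
  defines "acc \<equiv> ask d L x (slack d l) (quota l) \<le> ip d x y"
  defines "L' \<equiv> learn d L x (slack d l) (quota l) acc"
  shows "y \<in> consistent d L'" "wf_constraints d L'"
    and "potential d \<Lambda> L' \<le> potential d \<Lambda> L"
    and "finite \<Lambda> \<Longrightarrow> l \<in> \<Lambda> \<Longrightarrow> (if sep \<and> \<not> acc then 2 else 2 * w) \<le> potential d \<Lambda> L - potential d \<Lambda> L'"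
proof -
  show y': "y \<in> consistent d L'" unfolding L'_def acc_def using x y by (rule consistent_learn)
  show L': "wf_constraints d L'" unfolding L'_def using L x by (rule wf_learn)
  have vol: "vol d L' z \<le> vol d L z" for z unfolding L'_def by (rule vol_learn_le)
  show "potential d \<Lambda> L' \<le> potential d \<Lambda> L" using y' L' d vol by (rule potential_antimono)
  assume \<Lambda>: "finite \<Lambda>" "l \<in> \<Lambda>"
  have "consistent d L \<noteq> {}" using y by auto
  then have w2: "w \<le> 2" using lo_ge[OF x] hi_le[OF x] w(1) by fastforce
  define r where "r = (if acc then 1 - quota l / 2 else 2 * quota l)"
  have "vol d L' (slack d l) \<le> r * vol d L (slack d l)"
    unfolding L'_def acc_def r_def
    using x y vol_slack_pos[OF y L d] slack_pos[OF d] slack_level_of[OF w(2) w2 d, of sep]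
      quota_pos quota_le d w(1) unfolding l_def
    by (intro vol_learn[where w = w]) auto
  moreover have "r > 0" using quota_pos[of l] quota_le[of l] by (auto simp: r_def)
  ultimately have "weight l * (- ln r) \<le> potential d \<Lambda> L - potential d \<Lambda> L'"
    using y' L' d vol \<Lambda> by (intro potential_drop) auto
  moreover have "(if sep \<and> \<not> acc then 2 else 2 * w) \<le> weight l * (- ln r)"
    using weight_level_of[OF w(2) w2, of sep] unfolding l_def[symmetric] r_def by (auto split: if_splits)
  ultimately show "(if sep \<and> \<not> acc then 2 else 2 * w) \<le> potential d \<Lambda> L - potential d \<Lambda> L'" by linarith
qed

section \<open>The levels that occur for widths above \<open>1 / T\<close>\<close>

definition overlap_levels :: "nat \<Rightarrow> level set" where
  "overlap_levels T = Overlap ` {..T}"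

text \<open>The condition says that the upper end \<open>8 / v^2\<close> of the range exceeds
  \<open>1 / T\<close>. Here the number of levels enters the regret, whereas for overlap levels the
  crude bound \<open>k \<le> T\<close> is harmless because of geometric decay.\<close>

definition separated_levels :: "nat \<Rightarrow> level set" where
  "separated_levels T = Separated ` {i. (2 ^ 2 ^ i) ^ 2 < 8 * real T}"

definition levels :: "nat \<Rightarrow> level set" where
  "levels T = overlap_levels T \<union> separated_levels T"

text \<open>For \<open>T \<ge> 3\<close>, \<open>8 * T \<le> T ^ 3\<close>; one logarithm gives
  \<open>2 ^ i \<le> 9/4 * ln T\<close>, a second one the claim. Also \<open>T \<ge> 3 > e\<close>
  makes \<open>ln (ln T)\<close> nonnegative.\<close>

lemma separated_level_bound:
  assumes "(2 ^ 2 ^ i) ^ 2 < 8 * real T" "T \<ge> 3"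
  shows "real i \<le> 3 + 2 * ln (ln (real T))"
proof -
  have T2: "3 * 3 \<le> real T * real T" using assms(2) by (intro mult_mono) auto
  have "8 * real T \<le> (real T * real T) * real T" using T2 by (intro mult_right_mono) auto
  then have "(2 ^ 2 ^ i) ^ 2 < real T ^ 3" using assms(1) by (simp add: power3_eq_cube)
  then have "ln ((2 ^ 2 ^ i) ^ 2) \<le> ln (real T ^ 3)" by (intro ln_mono) auto
  then have 1: "2 * (2 ^ i * ln 2) \<le> 3 * ln (real T)" using assms(2) by (simp add: ln_realpow)
  have "2 ^ i * (2 / 3) \<le> 2 ^ i * ln (2::real)" using ln2_ge_two_thirds by (intro mult_left_mono) auto
  then have 2: "2 ^ i \<le> 9 / 4 * ln (real T)" using 1 by linarith
  have "ln (exp 1) \<le> ln (real T)" using exp_le assms(2) by (intro ln_mono) auto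
  then have lnT: "1 \<le> ln (real T)" by simp
  have "ln (2 ^ i) \<le> ln (9 / 4 * ln (real T))" using 2 by (intro ln_mono) auto
  also have "\<dots> = ln (9 / 4) + ln (ln (real T))" using lnT by (subst ln_mult_pos) auto
  also have "\<dots> \<le> 5 / 4 + ln (ln (real T))" using ln_le_minus_one[of "9 / 4"] by simp
  finally have "real i * ln 2 \<le> 5 / 4 + ln (ln (real T))" by (simp add: ln_realpow)
  moreover have "real i * (2 / 3) \<le> real i * ln 2"
    using ln2_ge_two_thirds by (intro mult_left_mono) auto
  moreover have "0 \<le> ln (ln (real T))" using lnT by simp
  ultimately show ?thesis by linarith
qed

lemma finite_levels: 
  assumes "T \<ge> 3"
  shows "finite (overlap_levels T)" "finite (levels T)"
proof -
  have "{i. (2 ^ 2 ^ i) ^ 2 < 8 * real T} \<subseteq> {..nat \<lceil>3 + 2 * ln (ln (real T))\<rceil>}"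
  proof safe
    fix i assume "(2 ^ 2 ^ i) ^ 2 < 8 * real T"
    then have "real i \<le> 3 + 2 * ln (ln (real T))" using assms by (rule separated_level_bound)
    then show "i \<le> nat \<lceil>3 + 2 * ln (ln (real T))\<rceil>" by linarith
  qed
  then show "finite (overlap_levels T)" "finite (levels T)"
    by (auto simp: overlap_levels_def levels_def separated_levels_def intro: finite_subset)
qed

lemma level_of_in_levels:
  assumes "1 / real T < w" "w \<le> 2" "T > 0"
  shows "level_of False w \<in> overlap_levels T" "level_of sep w \<in> levels T"
proof -
  have w0: "w > 0" using assms(1,3) by (smt (verit) of_nat_0_less_iff zero_less_divide_1_iff)
  obtain k where k: "level_of False w = Overlap k" "w \<le> 2 / 2 ^ k"
    using level_of_overlap[OF w0 assms(2)] .
  have "1 / real T < 2 / 2 ^ k" using assms(1) k(2) by linarith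
  then have "2 ^ k < 2 * real T" using assms(3) by (simp add: field_simps)
  then have "2 ^ k < 2 * T" by (metis of_nat_less_iff of_nat_mult of_nat_numeral of_nat_power)
  have "k \<le> T"
  proof (rule ccontr)
    assume "\<not> k \<le> T"
    then have "2 ^ Suc T \<le> (2::nat) ^ k" by (intro power_increasing) auto
    moreover have "T < 2 ^ T" by (rule less_exp)
    ultimately show False using \<open>2 ^ k < 2 * T\<close> by simp
  qed
  then show ov: "level_of False w \<in> overlap_levels T" by (simp add: k overlap_levels_def)
  show "level_of sep w \<in> levels T"
  proof (cases sep)
    case True
    obtain i where i: "level_of True w = Separated i" "w \<le> 8 / (2 ^ 2 ^ i) ^ 2"
      using level_of_separated[OF w0 assms(2)] .
    have "1 / real T < 8 / (2 ^ 2 ^ i) ^ 2" using assms(1) i(2) by linarith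
    then have "(2 ^ 2 ^ i) ^ 2 < 8 * real T" using assms(3) by (simp add: field_simps)
    then show ?thesis using True i(1) by (simp add: levels_def separated_levels_def)
  qed (use ov in \<open>simp add: levels_def\<close>)
qed

section \<open>The trading policy\<close>

text \<open>The first component constrains the seller's vector, the second one the buyer's. Probing the
  seller in direction \<open>x\<close> is probing a buyer in direction \<open>-x\<close> with the negated price.\<close>

type_synonym state = "(rvec \<times> real) list \<times> (rvec \<times> real) list"

definition width :: "nat \<Rightarrow> (rvec \<times> real) list \<Rightarrow> rvec \<Rightarrow> real" where
  "width d L x = hi d L x - lo d L x"

definition probe_level :: "nat \<Rightarrow> (rvec \<times> real) list \<Rightarrow> (rvec \<times> real) list \<Rightarrow> rvec \<Rightarrow> level" where
  "probe_level d Ls Lb x = level_of (hi d Ls x \<le> lo d Lb x) (max (width d Ls x) (width d Lb x))"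

text \<open>The prices \<open>(- 2, 2)\<close> lie outside the range \<open>[-1, 1]\<close> of
  valuations and prevent a trade that cannot gain. At widths up to \<open>1 / T\<close> both prices
  are safe, and such rounds cost at most 2 in total.\<close>

fun post :: "nat \<Rightarrow> nat \<Rightarrow> state \<Rightarrow> rvec \<Rightarrow> real \<times> real" where
  "post d T (Ls, Lb) x = (let l = probe_level d Ls Lb x in
     if hi d Lb x < lo d Ls x then (- 2, 2)
     else if max (width d Ls x) (width d Lb x) \<le> 1 / real T then (hi d Ls x, lo d Lb x)
     else if width d Ls x \<le> width d Lb x then (hi d Ls x, ask d Lb x (slack d l) (quota l))
     else (- ask d Ls (\<lambda>i. - x i) (slack d l) (quota l), lo d Lb x))"

fun update :: "nat \<Rightarrow> nat \<Rightarrow> state \<Rightarrow> rvec \<Rightarrow> bool \<Rightarrow> state" where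
  "update d T (Ls, Lb) x acc = (let l = probe_level d Ls Lb x in
     if hi d Lb x < lo d Ls x \<or> max (width d Ls x) (width d Lb x) \<le> 1 / real T then (Ls, Lb)
     else if width d Ls x \<le> width d Lb x then (Ls, learn d Lb x (slack d l) (quota l) acc)
     else (learn d Ls (\<lambda>i. - x i) (slack d l) (quota l) acc, Lb))"

text \<open>A policy sees only the history, so the state is recomputed by replaying it.\<close>

definition state_of :: "nat \<Rightarrow> nat \<Rightarrow> (rvec \<times> bool) list \<Rightarrow> state" where
  "state_of d T h = foldl (\<lambda>st (x, acc). update d T st x acc) ([], []) h"

definition trade_policy :: "nat \<Rightarrow> nat \<Rightarrow> policy" where
  "trade_policy d T h x = post d T (state_of d T h) x"

definition consistent_state :: "nat \<Rightarrow> rvec \<Rightarrow> rvec \<Rightarrow> state \<Rightarrow> bool" where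
  "consistent_state d s b st \<longleftrightarrow>
     s \<in> consistent d (fst st) \<and> wf_constraints d (fst st) \<and>
     b \<in> consistent d (snd st) \<and> wf_constraints d (snd st)"

definition state_potential :: "nat \<Rightarrow> level set \<Rightarrow> state \<Rightarrow> real" where
  "state_potential d \<Lambda> st = potential d \<Lambda> (fst st) + potential d \<Lambda> (snd st)"

lemma lo_uminus [simp]: "lo d L (\<lambda>i. - x i) = - hi d L x"
  by (simp add: hi_def)

lemma hi_uminus [simp]: "hi d L (\<lambda>i. - x i) = - lo d L x"
  by (simp add: hi_def)

text \<open>Regret is charged to all levels, negative profit to the overlap levels only: at
  separated intervals the posted prices never lose money.\<close>

lemma round_progress:
  assumes st: "consistent_state d s b st" and x: "ip d x x \<le> 1" and d: "d > 0" and T: "T \<ge> 3"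
  defines "p \<equiv> fst (post d T st x)" and "q \<equiv> snd (post d T st x)"
  defines "st' \<equiv> update d T st x (trade (ip d s x) (ip d b x) p q)"
  shows "consistent_state d s b st'"
    and "max 0 (ip d b x - ip d s x) - profit (ip d s x) (ip d b x) p q
      \<le> state_potential d (levels T) st - state_potential d (levels T) st' + 2 / real T"
    and "max 0 (- profit (ip d s x) (ip d b x) p q)
      \<le> state_potential d (overlap_levels T) st - state_potential d (overlap_levels T) st' + 2 / real T"
proof -
  obtain Ls Lb where L: "st = (Ls, Lb)" by fastforce
  define sl sh bl bh where "sl = lo d Ls x" and "sh = hi d Ls x" and "bl = lo d Lb x" and "bh = hi d Lb x"
  define s' b' where "s' = ip d s x" and "b' = ip d b x"
  define w where "w = max (sh - sl) (bh - bl)"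
  define l where "l = level_of (sh \<le> bl) w"
  have s: "s \<in> consistent d Ls" "wf_constraints d Ls" and b: "b \<in> consistent d Lb" "wf_constraints d Lb"
    using st by (auto simp: consistent_state_def L)
  have x': "ip d (\<lambda>i. - x i) (\<lambda>i. - x i) \<le> 1" using x by simp
  have ne: "consistent d Ls \<noteq> {}" "consistent d Lb \<noteq> {}" using s b by auto
  have bounds: "sl \<le> s'" "s' \<le> sh" "bl \<le> b'" "b' \<le> bh"
    using lo_le[OF x s(1)] le_hi[OF x s(1)] lo_le[OF x b(1)] le_hi[OF x b(1)]
    by (auto simp: sl_def sh_def bl_def bh_def s'_def b'_def ip_commute[of d _ x])
  have ranges: "- 1 \<le> sl" "sh \<le> 1" "- 1 \<le> bl" "bh \<le> 1"
    using lo_ge[OF x ne(1)] hi_le[OF x ne(1)] lo_ge[OF x ne(2)] hi_le[OF x ne(2)]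
    by (auto simp: sl_def sh_def bl_def bh_def)
  have T0: "0 < 1 / real T" "2 / real T = 2 * (1 / real T)" using T by auto
  have T2: "0 \<le> 2 / real T" by simp
  note fin = finite_levels[OF T]
  have post: "post d T st x = (if bh < sl then (- 2, 2)
     else if w \<le> 1 / real T then (sh, bl)
     else if sh - sl \<le> bh - bl then (sh, ask d Lb x (slack d l) (quota l))
     else (- ask d Ls (\<lambda>i. - x i) (slack d l) (quota l), bl))"
    by (simp add: L Let_def probe_level_def width_def l_def w_def sl_def sh_def bl_def bh_def)
  have update: "update d T st x acc = (if bh < sl \<or> w \<le> 1 / real T then st
     else if sh - sl \<le> bh - bl then (Ls, learn d Lb x (slack d l) (quota l) acc)
     else (learn d Ls (\<lambda>i. - x i) (slack d l) (quota l) acc, Lb))" for acc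
    by (simp add: L Let_def probe_level_def width_def l_def w_def sl_def sh_def bl_def bh_def)
  consider (none) "bh < sl" | (tiny) "sl \<le> bh" "w \<le> 1 / real T"
    | (buyer) "sl \<le> bh" "1 / real T < w" "sh - sl \<le> bh - bl"
    | (seller) "sl \<le> bh" "1 / real T < w" "bh - bl < sh - sl"
    by linarith
  then have "consistent_state d s b st' \<and>
    max 0 (b' - s') - profit s' b' p q
      \<le> state_potential d (levels T) st - state_potential d (levels T) st' + 2 / real T \<and>
    max 0 (- profit s' b' p q)
      \<le> state_potential d (overlap_levels T) st - state_potential d (overlap_levels T) st' + 2 / real T"
  proof cases
    case none
    then have "st' = st" "p = - 2" "q = 2" by (auto simp: st'_def update p_def q_def post)
    moreover have "profit s' b' (- 2) 2 = 0" using bounds ranges by (simp add: profit_def trade_def)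
    ultimately show ?thesis using st none bounds T0 by auto
  next
    \<comment> \<open>Trade is certain. Since \<open>sl \<le> bh\<close>, both the regret and
      \<open>sh - bl\<close> are at most the sum of the two widths.\<close>
    case tiny
    then have eqs: "st' = st" "p = sh" "q = bl" by (auto simp: st'_def update p_def q_def post)
    have "sh - sl \<le> 1 / real T" "bh - bl \<le> 1 / real T" using tiny by (auto simp: w_def)
    moreover have "profit s' b' sh bl = bl - sh" using bounds by (simp add: profit_def trade_def)
    ultimately show ?thesis
      using st tiny(1) bounds T0 by (simp add: eqs)
  next
    case buyer
    let ?q = "ask d Lb x (slack d l) (quota l)"
    have w: "w = bh - bl" using buyer by (simp add: w_def)
    have pq: "p = sh" "q = ?q" using buyer by (auto simp: p_def q_def post)
    have tr: "trade s' b' p q \<longleftrightarrow> ?q \<le> ip d x b"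
      using bounds by (simp add: trade_def pq b'_def ip_commute)
    have st': "st' = (Ls, learn d Lb x (slack d l) (quota l) (?q \<le> ip d x b))"
      using buyer tr by (simp add: st'_def update s'_def b'_def)
    have qb: "bl \<le> ?q" "?q \<le> bh" using ask_bounds[OF x b(1)] by (auto simp: bl_def bh_def)
    have w0: "0 < w" using buyer T0 by linarith
    have w2: "w \<le> 2" using ranges w by linarith
    have wd: "w = hi d Lb x - lo d Lb x" using w by (simp add: bl_def bh_def)
    note pr = probe_progress[OF x b wd w0 d, where sep = "sh \<le> bl", folded l_def]
    have lv: "l \<in> levels T" "\<not> sh \<le> bl \<Longrightarrow> l \<in> overlap_levels T"
      using level_of_in_levels[OF buyer(2) w2] T by (auto simp: l_def)
    have D1: "(if sh \<le> bl \<and> \<not> trade s' b' p q then 2 else 2 * w) \<le> state_potential d (levels T) st - state_potential d (levels T) st'"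
      using pr(4)[OF fin(2) lv(1)] by (simp add: L st' state_potential_def tr)
    have D2: "0 \<le> state_potential d (overlap_levels T) st - state_potential d (overlap_levels T) st'"
      using pr(3)[of "overlap_levels T"] by (simp add: L st' state_potential_def)
    have D3: "2 * w \<le> state_potential d (overlap_levels T) st - state_potential d (overlap_levels T) st'" if "\<not> sh \<le> bl"
      using pr(4)[OF fin(1) lv(2)[OF that]] that by (simp add: L st' state_potential_def)
    have cons: "consistent_state d s b st'" using pr(1,2) s by (simp add: st' consistent_state_def)
    \<comment> \<open>A trade with \<open>s' \<le> b'\<close> loses
      \<open>(b' - q) + (p - s')\<close>, at most \<open>w\<close> each. For overlapping intervals,
      \<open>bh - sl\<close> and \<open>sh - bl\<close> are at most \<open>2 * w\<close>, which
      covers the remaining cases except a failed trade at separated intervals, bounded by 2.\<close>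
    have B1: "max 0 (b' - s') - profit s' b' p q \<le> (if sh \<le> bl \<and> \<not> trade s' b' p q then 2 else 2 * w)"
      using bounds qb ranges buyer w by (auto simp: profit_def pq max_def)
    \<comment> \<open>If separated, \<open>q \<ge> bl \<ge> sh = p\<close>.\<close>
    have B2: "max 0 (- profit s' b' p q) \<le> (if sh \<le> bl then 0 else 2 * w)"
      using qb buyer w w0 by (auto simp: profit_def pq max_def)
    moreover have "max 0 (- profit s' b' p q)
        \<le> state_potential d (overlap_levels T) st - state_potential d (overlap_levels T) st' + 2 / real T"
      using B2 D2 D3 T2 by (smt (verit))
    ultimately show ?thesis using cons order_trans[OF B1 D1] T2 by linarith
  next
    case seller
    let ?q = "ask d Ls (\<lambda>i. - x i) (slack d l) (quota l)"
    have w: "w = sh - sl" using seller by (simp add: w_def)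
    have pq: "p = - ?q" "q = bl" using seller by (auto simp: p_def q_def post)
    \<comment> \<open>The seller accepts \<open>- ?q\<close> exactly when a buyer with valuation
      \<open>- s'\<close> accepts \<open>?q\<close>.\<close>
    have tr: "trade s' b' p q \<longleftrightarrow> ?q \<le> ip d (\<lambda>i. - x i) s"
      using bounds by (auto simp: trade_def pq s'_def ip_commute[of d s x])
    have st': "st' = (learn d Ls (\<lambda>i. - x i) (slack d l) (quota l) (?q \<le> ip d (\<lambda>i. - x i) s), Lb)"
      using seller tr by (simp add: st'_def update s'_def b'_def)
    have qb: "- sh \<le> ?q" "?q \<le> - sl" using ask_bounds[OF x' s(1)] by (auto simp: sl_def sh_def)
    have w0: "0 < w" using seller T0 by linarith
    have w2: "w \<le> 2" using ranges w by linarith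
    have wd: "w = hi d Ls (\<lambda>i. - x i) - lo d Ls (\<lambda>i. - x i)" using w by (simp add: sl_def sh_def)
    note pr = probe_progress[OF x' s wd w0 d, where sep = "sh \<le> bl", folded l_def]
    have lv: "l \<in> levels T" "\<not> sh \<le> bl \<Longrightarrow> l \<in> overlap_levels T"
      using level_of_in_levels[OF seller(2) w2] T by (auto simp: l_def)
    have D1: "(if sh \<le> bl \<and> \<not> trade s' b' p q then 2 else 2 * w) \<le> state_potential d (levels T) st - state_potential d (levels T) st'"
      using pr(4)[OF fin(2) lv(1)] by (simp add: L st' state_potential_def tr)
    have D2: "0 \<le> state_potential d (overlap_levels T) st - state_potential d (overlap_levels T) st'"
      using pr(3)[of "overlap_levels T"] by (simp add: L st' state_potential_def)
    have D3: "2 * w \<le> state_potential d (overlap_levels T) st - state_potential d (overlap_levels T) st'" if "\<not> sh \<le> bl"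
      using pr(4)[OF fin(1) lv(2)[OF that]] that by (simp add: L st' state_potential_def)
    have cons: "consistent_state d s b st'" using pr(1,2) b by (simp add: st' consistent_state_def)
    have B1: "max 0 (b' - s') - profit s' b' p q \<le> (if sh \<le> bl \<and> \<not> trade s' b' p q then 2 else 2 * w)"
      using bounds qb ranges seller w by (auto simp: profit_def pq max_def)
    have B2: "max 0 (- profit s' b' p q) \<le> (if sh \<le> bl then 0 else 2 * w)"
      using qb seller w w0 by (auto simp: profit_def pq max_def)
    moreover have "max 0 (- profit s' b' p q)
        \<le> state_potential d (overlap_levels T) st - state_potential d (overlap_levels T) st' + 2 / real T"
      using B2 D2 D3 T2 by (smt (verit))
    ultimately show ?thesis using cons order_trans[OF B1 D1] T2 by linarith
  qed
  then show "consistent_state d s b st'"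
    and "max 0 (ip d b x - ip d s x) - profit (ip d s x) (ip d b x) p q
      \<le> state_potential d (levels T) st - state_potential d (levels T) st' + 2 / real T"
    and "max 0 (- profit (ip d s x) (ip d b x) p q)
      \<le> state_potential d (overlap_levels T) st - state_potential d (overlap_levels T) st' + 2 / real T"
    by (auto simp: s'_def b'_def)
qed

lemma ip_le_1_if_unit_ball: "v \<in> unit_ball d \<Longrightarrow> ip d v v \<le> 1"
  by (auto simp: unit_ball_def)

text \<open>The round bounds telescope. The horizon \<open>T\<close> stays fixed in the induction on
  \<open>n\<close> because the policy depends on it.\<close>

lemma trade_policy_amortized:
  assumes inst: "valid_instance d T s b x" and d: "d > 0" and T: "T \<ge> 3" and n: "n \<le> T"
  defines "st \<equiv> state_of d T (hist d (trade_policy d T) s b x n)"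
  shows "consistent_state d s b st \<and>
    (\<Sum>t=1..n. max 0 (ip d b (x t) - ip d s (x t)) - round_profit d (trade_policy d T) s b x t)
      \<le> state_potential d (levels T) ([], []) - state_potential d (levels T) st + real n * (2 / real T) \<and>
    (\<Sum>t=1..n. max 0 (- round_profit d (trade_policy d T) s b x t))
      \<le> state_potential d (overlap_levels T) ([], []) - state_potential d (overlap_levels T) st + real n * (2 / real T)"
  using n unfolding st_def
proof (induction n)
  case 0
  show ?case
    using inst by (auto simp: state_of_def consistent_state_def consistent_def wf_constraints_def
        valid_instance_def ip_le_1_if_unit_ball)
next
  case (Suc n)
  let ?P = "trade_policy d T"
  let ?st = "state_of d T (hist d ?P s b x n)"
  let ?pq = "post d T ?st (x (Suc n))"
  have st: "consistent_state d s b ?st" using Suc by simp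
  have x: "ip d (x (Suc n)) (x (Suc n)) \<le> 1"
    using inst Suc.prems by (intro ip_le_1_if_unit_ball) (auto simp: valid_instance_def)
  have pol: "?P (hist d ?P s b x n) (x (Suc n)) = ?pq" by (simp add: trade_policy_def)
  have st': "state_of d T (hist d ?P s b x (Suc n)) = update d T ?st (x (Suc n))
      (trade (ip d s (x (Suc n))) (ip d b (x (Suc n))) (fst ?pq) (snd ?pq))"
    by (simp add: Let_def state_of_def trade_policy_def)
  have rp: "round_profit d ?P s b x (Suc n) =
      profit (ip d s (x (Suc n))) (ip d b (x (Suc n))) (fst ?pq) (snd ?pq)"
    by (simp add: round_profit_def prices_def pol)
  have T2: "real (Suc n) * (2 / real T) = real n * (2 / real T) + 2 / real T"
    by (simp only: of_nat_Suc distrib_right mult_1 add.commute)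
  have IH: "consistent_state d s b ?st"
    "(\<Sum>t=1..n. max 0 (ip d b (x t) - ip d s (x t)) - round_profit d ?P s b x t)
      \<le> state_potential d (levels T) ([], []) - state_potential d (levels T) ?st + real n * (2 / real T)"
    "(\<Sum>t=1..n. max 0 (- round_profit d ?P s b x t))
      \<le> state_potential d (overlap_levels T) ([], []) - state_potential d (overlap_levels T) ?st + real n * (2 / real T)"
    using Suc by auto
  note step = round_progress[OF st x d T, folded st' rp]
  have sums: "(\<Sum>t=1..Suc n. f t) = (\<Sum>t=1..n. f t) + f (Suc n)" for f :: "nat \<Rightarrow> real"
    by simp
  show ?case
    unfolding T2 sums using step IH(2,3) by linarith
qed

section \<open>Total budget\<close>

text \<open>The closed form shows that the sum stays below 28 for all \<open>n\<close>;
  \<open>13 + k\<close> is the factor of \<open>ln d\<close> from the logarithm at level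
  \<open>k\<close>.\<close>

lemma sum_overlap_weights: "(\<Sum>k\<le>n. (13 + real k) / 2 ^ k) = 28 - (15 + real n) / 2 ^ n"
  by (induction n) (auto simp: field_simps)

text \<open>As \<open>d \<ge> 2\<close>, constants become powers of \<open>d\<close>:
  \<open>1280 \<le> 2 ^ 11 \<le> d ^ 11\<close>, and \<open>2 ^ k \<le> d ^ k\<close>.\<close>

lemma ln_two_div_slack_Overlap:
  assumes "d \<ge> 2"
  shows "ln (2 * real d / slack d (Overlap k)) \<le> (13 + real k) * ln (real d)"
proof -
  have "ln (2 * real d / slack d (Overlap k)) = ln (1280 * real d ^ 2 * 2 ^ k)"
    by (simp add: power2_eq_square algebra_simps)
  also have "\<dots> \<le> ln (real d ^ 11 * real d ^ 2 * real d ^ k)"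
  proof (intro ln_mono mult_mono)
    have "(2::real) ^ 11 \<le> real d ^ 11" using assms by (intro power_mono) auto
    then show "1280 \<le> real d ^ 11" by simp
    show "2 ^ k \<le> real d ^ k" using assms by (intro power_mono) auto
  qed (use assms in auto)
  also have "real d ^ 11 * real d ^ 2 * real d ^ k = real d ^ (13 + k)" by (simp add: power_add[symmetric])
  also have "ln (real d ^ (13 + k)) = (13 + real k) * ln (real d)" using assms by (simp add: ln_realpow)
  finally show ?thesis .
qed

text \<open>Only 160 is absorbed into powers of \<open>d\<close>. The doubly exponential factor
  stays apart, so that its contribution \<open>5 * 2 ^ i\<close> carries no
  \<open>ln d\<close>.\<close>

lemma ln_two_div_slack_Separated:
  assumes "d \<ge> 2"
  shows "ln (2 * real d / slack d (Separated i)) \<le> 10 * ln (real d) + 5 * 2 ^ i"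
proof -
  have "2 * real d / slack d (Separated i) = 160 * real d ^ 2 * (2 ^ 2 ^ i) ^ 5"
    by (simp add: power2_eq_square algebra_simps)
  also have "ln \<dots> = ln (160 * real d ^ 2) + 5 * 2 ^ i * ln 2"
    using assms by (subst ln_mult_pos) (auto simp: ln_realpow)
  also have "\<dots> \<le> ln (real d ^ 8 * real d ^ 2) + 5 * 2 ^ i * 1"
  proof (intro add_mono ln_mono mult_mono)
    have "(2::real) ^ 8 \<le> real d ^ 8" using assms by (intro power_mono) auto
    then show "160 \<le> real d ^ 8" by simp
  qed (use assms ln_2_less_1 in auto)
  also have "real d ^ 8 * real d ^ 2 = real d ^ 10" by (simp add: power_add[symmetric])
  also have "ln (real d ^ 10) = 10 * ln (real d)" using assms by (simp add: ln_realpow)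
  finally show ?thesis by simp
qed

lemma overlap_budget:
  assumes "d \<ge> 2"
  shows "(\<Sum>l\<in>overlap_levels T. weight l * (real d * ln (2 * real d / slack d l)))
    \<le> 896 * (real d * ln (real d))"
proof -
  have "(\<Sum>l\<in>overlap_levels T. weight l * (real d * ln (2 * real d / slack d l)))
    = (\<Sum>k\<le>T. weight (Overlap k) * (real d * ln (2 * real d / slack d (Overlap k))))"
    unfolding overlap_levels_def by (subst sum.reindex) (auto simp: inj_on_def)
  also have "\<dots> \<le> (\<Sum>k\<le>T. 32 / 2 ^ k * (real d * ((13 + real k) * ln (real d))))"
    unfolding weight.simps by (intro sum_mono mult_left_mono ln_two_div_slack_Overlap assms) auto
  also have "\<dots> = 32 * (real d * ln (real d)) * (\<Sum>k\<le>T. (13 + real k) / 2 ^ k)"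
    unfolding sum_distrib_left by (intro sum.cong) auto
  also have "\<dots> \<le> 32 * (real d * ln (real d)) * 28"
    using assms unfolding sum_overlap_weights by (intro mult_left_mono) auto
  finally show ?thesis by simp
qed

lemma separated_budget:
  assumes d: "d \<ge> 2" and T: "T \<ge> 3"
  shows "(\<Sum>l\<in>separated_levels T. weight l * (real d * ln (2 * real d / slack d l)))
    \<le> 6600 * (real d * ln (real d)) + 1320 * (real d * ln (ln (real T)))"
proof -
  let ?A = "{i. (2 ^ 2 ^ i) ^ 2 < 8 * real T}"
  let ?u = "3 + 2 * ln (ln (real T))"
  define m where "m = nat \<lfloor>?u\<rfloor>"
  have bound: "real i \<le> ?u" if "i \<in> ?A" for i using separated_level_bound[of i T] that T by simp
  have sub: "?A \<subseteq> {..m}" unfolding m_def using bound by (blast intro: le_nat_floor)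
  have "0 \<in> ?A" using T by simp
  then have "0 \<le> ?u" using bound[of 0] by simp
  then have m: "real m \<le> ?u" unfolding m_def by (rule of_nat_floor)
  have lnd: "2 / 3 \<le> ln (real d)" 
  proof -
    have "ln 2 \<le> ln (real d)" using d by (intro ln_mono) auto
    then show ?thesis using ln2_ge_two_thirds by linarith
  qed
  have "(\<Sum>l\<in>separated_levels T. weight l * (real d * ln (2 * real d / slack d l)))
    = (\<Sum>i\<in>?A. weight (Separated i) * (real d * ln (2 * real d / slack d (Separated i))))"
    unfolding separated_levels_def by (subst sum.reindex) (auto simp: inj_on_def)
  also have "\<dots> \<le> (\<Sum>i\<in>?A. real d * (1320 * ln (real d) * (1 / 2) ^ i + 660))"
  proof (rule sum_mono)
    fix i
    \<comment> \<open>The weight is thus of order \<open>1 / 2 ^ i\<close>: the \<open>ln d\<close>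
      part sums geometrically, while the part \<open>5 * 2 ^ i\<close> costs 660 per level, hence
      \<open>ln (ln T)\<close>.\<close>
    have "(2::real) ^ i \<le> 2 ^ 2 ^ i" using less_exp[of i] by (intro power_increasing) auto
    then have "128 / 2 ^ 2 ^ i \<le> 128 / (2::real) ^ i" by (intro divide_left_mono) auto
    then have wt: "weight (Separated i) \<le> 132 / 2 ^ i" by simp
    have "weight (Separated i) * (real d * ln (2 * real d / slack d (Separated i)))
      \<le> weight (Separated i) * (real d * (10 * ln (real d) + 5 * 2 ^ i))"
      by (intro mult_left_mono weight_nonneg ln_two_div_slack_Separated d) auto
    also have "\<dots> \<le> 132 / 2 ^ i * (real d * (10 * ln (real d) + 5 * 2 ^ i))"
      using wt lnd by (intro mult_right_mono mult_nonneg_nonneg) auto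
    also have "\<dots> = real d * (1320 * ln (real d) * (1 / 2) ^ i + 660)"
      by (simp add: field_simps power_one_over)
    finally show "weight (Separated i) * (real d * ln (2 * real d / slack d (Separated i)))
      \<le> real d * (1320 * ln (real d) * (1 / 2) ^ i + 660)" .
  qed
  also have "\<dots> \<le> (\<Sum>i\<le>m. real d * (1320 * ln (real d) * (1 / 2) ^ i + 660))"
    using sub lnd by (intro sum_mono2) auto
  also have "\<dots> = real d * (1320 * ln (real d) * (\<Sum>i\<le>m. (1 / 2) ^ i) + 660 * (real m + 1))"
    by (simp add: sum.distrib flip: sum_distrib_left)
  also have "\<dots> \<le> real d * (1320 * ln (real d) * 2 + 660 * (?u + 1))"
  proof -
    have "(\<Sum>i\<le>m. (1 / 2 :: real) ^ i) \<le> 2" by (simp add: sum_gp0)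
    then show ?thesis using lnd m by (intro mult_left_mono add_mono) auto
  qed
  \<comment> \<open>The constant 660 * 4 = 2640 is at most \<open>3960 * ln d\<close>, as
    \<open>ln d \<ge> 2/3\<close>; then 2640 + 3960 = 6600.\<close>
  also have "\<dots> \<le> real d * (6600 * ln (real d) + 1320 * ln (ln (real T)))"
    using lnd by (intro mult_left_mono) auto
  finally show ?thesis by (simp add: algebra_simps)
qed

theorem theorem5p5:
  shows "\<exists>C::real. \<forall>d T::nat. d \<ge> 2 \<and> T \<ge> 3 \<longrightarrow>
    (\<exists>A :: policy pmf.
       (\<forall>s b x. valid_instance d T s b x \<longrightarrow>
          measure_pmf.expectation A (\<lambda>P. loss d T P s b x)
            \<le> C * (real d * ln (ln (real T)) + real d * ln (real d)))
     \<and> (\<forall>P\<in>set_pmf A. \<forall>s b x. valid_instance d T s b x \<longrightarrow>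
          neg_profit d T P s b x \<le> C * (real d * ln (real d))))"
proof (intro exI[of _ "20000"] allI impI, elim conjE)
  \<comment> \<open>20000 exceeds 2 * (896 + 6600) + 2: a factor 2 for seller and buyer, and the
    additive 2 of the tiny rounds absorbed by \<open>2 * (d * ln d)\<close>.\<close>
  fix d T :: nat assume d: "d \<ge> 2" and T: "T \<ge> 3"
  have "ln 2 \<le> ln (real d)" using d by (intro ln_mono) auto
  then have "2 / 3 \<le> ln (real d)" using ln2_ge_two_thirds by linarith
  then have "2 * (2 / 3) \<le> real d * ln (real d)" using d by (intro mult_mono) auto
  then have dlnd: "2 \<le> 2 * (real d * ln (real d))" by simp
  have "ln (exp 1) \<le> ln (real T)" using exp_le T by (intro ln_mono) auto
  then have dlnlnT: "0 \<le> real d * ln (ln (real T))" by simp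
  have main: "loss d T (trade_policy d T) s b x
        \<le> 20000 * (real d * ln (ln (real T)) + real d * ln (real d)) \<and>
      neg_profit d T (trade_policy d T) s b x \<le> 20000 * (real d * ln (real d))"
    if inst: "valid_instance d T s b x" for s b x
  proof -
    define st where "st = state_of d T (hist d (trade_policy d T) s b x T)"
    let ?B = "\<lambda>\<Lambda>. \<Sum>l\<in>\<Lambda>. weight l * (real d * ln (2 * real d / slack d l))"
    have d0: "d > 0" using d by simp
    have am: "consistent_state d s b st"
        "loss d T (trade_policy d T) s b x \<le> state_potential d (levels T) ([], []) - state_potential d (levels T) st + 2"
        "neg_profit d T (trade_policy d T) s b x
          \<le> state_potential d (overlap_levels T) ([], []) - state_potential d (overlap_levels T) st + 2"
      using trade_policy_amortized[OF inst d0 T order_refl] T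
      by (auto simp: st_def loss_def neg_profit_def sum_subtractf)
    have range: "state_potential d \<Lambda> ([], []) - state_potential d \<Lambda> st \<le> 2 * ?B \<Lambda>" for \<Lambda>
      using potential_range[of s d "fst st" \<Lambda>] potential_range[of b d "snd st" \<Lambda>] am(1) d
      by (simp add: state_potential_def consistent_state_def)
    have "?B (levels T) = ?B (overlap_levels T) + ?B (separated_levels T)"
      using finite_levels[OF T] unfolding levels_def
      by (intro sum.union_disjoint) (auto simp: overlap_levels_def separated_levels_def)
    then show ?thesis
      using am(2,3) range[of "levels T"] range[of "overlap_levels T"] overlap_budget[OF d, of T]
        separated_budget[OF d T] dlnd dlnlnT
      unfolding distrib_left by linarith
  qed
  show "\<exists>A :: policy pmf.
       (\<forall>s b x. valid_instance d T s b x \<longrightarrow>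
          measure_pmf.expectation A (\<lambda>P. loss d T P s b x)
            \<le> 20000 * (real d * ln (ln (real T)) + real d * ln (real d)))
     \<and> (\<forall>P\<in>set_pmf A. \<forall>s b x. valid_instance d T s b x \<longrightarrow>
          neg_profit d T P s b x \<le> 20000 * (real d * ln (real d)))"
    \<comment> \<open>The learner is deterministic, so its distribution is a point mass and the
      expectation is the loss itself.\<close>
    using main by (intro exI[of _ "return_pmf (trade_policy d T)"]) auto
qed

end
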